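(* Let $\mathscr{A}$ be an essential toric arrangement in $(\mathbb{C}^\times)^{d+1}$, with $\mathscr{P}(\mathscr{A}_Y)$ a corank-one TM-ideal of $\mathscr{P}(\mathscr{A})$, $\mathscr{A}\smallsetminus\mathscr{A}_Y=\{H_1,\dots,H_l\}$, and $\mathscr{B}=\mathscr{A}/Y$. Let $n=l+1$. On the basis $\{X_k\mid1\le k\le d\}\cup\{X_H\mid H\in\mathscr{B}\}$ of $H_1(M(\mathscr{B});\mathbb{Z})$, the homological root homomorphism $\mathbf{b}_*\colon H_1(M(\mathscr{B});\mathbb{Z})\to H_1(\mathrm{Conf}_n(\mathbb{C});\mathbb{Z})$ is given by $$\mathbf{b}_*(X_k)=\sum_{j=1}^{n-1}\Bigl[m_{j,k}A_{1,j+1}+\sum_{i=1}^{j-1}\nu_k(i,j)A_{i+1,j+1}\Bigr]\quad\text{and}\quad\mathbf{b}_*(X_H)=\sum A_{i+1,j+1},$$ the latter sum running over all $i<j$ for which $H$ is a connected component of $\pi(H_i\cap H_j)$.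
   Context: Toric arrangements. Let $\Gamma$ be a finitely generated free abelian group and $T=\mathrm{Hom}(\Gamma,\mathbb{C}^\times)$. For $\chi\in\Gamma$ put $H_\chi=\{t\in T\mid t(\chi)=1\}$. A toric arrangement $\mathscr{A}$ in $T$ is the set of all connected components of the $H_\chi$, $\chi\in\mathfrak{X}$, for a finite set $\mathfrak{X}\subseteq\Gamma\smallsetminus\{0\}$; its complement is $M(\mathscr{A})=T\smallsetminus\bigcup_{\chi\in\mathfrak X}H_\chi$; its poset of layers $\mathscr{P}(\mathscr{A})$ consists of the nonempty connected components of intersections $\bigcap_{\chi\in S}H_\chi$, $S\subseteq\mathfrak{X}$, ordered by reverse inclusion; $\mathscr{A}$ is essential if the maximal elements of $\mathscr{P}(\mathscr{A})$ are points. A subgroup $Y\subseteq T$ is admissible if there is a decomposition $\Gamma=\Gamma'\oplus\Gamma''$ with $\Gamma'$ of rank one and $Y=\{t\mid t|_{\Gamma''}\equiv1\}$. Let $p\colon T\to T/Y$ be the projection, $\mathscr{A}_Y=\{H\in\mathscr{A}\mid H\text{ is a union of cosets of }Y\}$, $\mathscr{A}/Y=\{p(H)\mid H\in\mathscr{A}_Y\}$, a toric arrangement in $T/Y$. $\mathscr{P}(\mathscr{A}_Y)$ is a corank-one TM-ideal of $\mathscr{P}(\mathscr{A})$ if $Y$ is admissible, $\mathscr{P}(\mathscr{A}_Y)$ has rank one less than $\mathscr{P}(\mathscr{A})$, for any distinct $H_1,H_2\in\mathscr{A}\smallsetminus\mathscr{A}_Y$ and any connected component $X$ of $H_1\cap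 H_2$ there is $H_3\in\mathscr{A}_Y$ with $H_3\supseteq X$, and $H\cap Y$ is connected for all $H\in\mathscr{A}\smallsetminus\mathscr{A}_Y$. Coordinates and root map. Choose coordinates $(\mathbf{x},y)=(x_1,\dots,x_d,y)$ on $T\cong(\mathbb{C}^\times)^{d+1}$ with $Y=\{\mathbf{x}=(1,\dots,1)\}$, and let $\pi(\mathbf{x},y)=\mathbf{x}$, so $\mathscr{B}$ is a toric arrangement in $(\mathbb{C}^\times)^d$. Write $\mathbf{x}^{\mathbf{m}}=x_1^{m_1}\cdots x_d^{m_d}$. The hypersurface $H_j$ is given by $y=\mu_j\mathbf{x}^{\mathbf{m}_j}$ with $\mathbf{m}_j=(m_{j,1},\dots,m_{j,d})\in\mathbb{Z}^d$ and $\mu_j$ a root of unity. The root map is $\mathbf{b}\colon M(\mathscr{B})\to\mathrm{Conf}_n(\mathbb{C})$, $\mathbf{x}\mapsto(0,\mu_1\mathbf{x}^{\mathbf{m}_1},\dots,\mu_l\mathbf{x}^{\mathbf{m}_l})$, where $\mathrm{Conf}_n(\mathbb{C})$ is the ordered configuration space. Bases. For each (connected) $H\in\mathscr{B}$ fix an equation $f_H(\mathbf{x})=\mathbf{x}^{\mathbf{m}_H}-\mu_H=0$ defining $H$, with $\mathbf{m}_H\in\mathbb{Z}^d$ primitive and $\mu_H$ a root of unity. The classes of $\zeta_k=\frac{1}{2\pi\sqrt{-1}}\mathrm{dlog}\,x_k$ ($1\le k\le d$) and $\omega_H=\frac{1}{2\pi\sqrt{-1}}\mathrm{dlog}\,f_H$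 ($H\in\mathscr{B}$) form a basis of $H^1(M(\mathscr{B});\mathbb{Z})$ (known). $\{X_k\}\cup\{X_H\}$ is the dual basis of $H_1(M(\mathscr{B});\mathbb{Z})$, with $X_k$ dual to $\zeta_k$ and $X_H$ dual to $\omega_H$. The classes $A_{r,s}$, $1\le r<s\le n$, form the basis of $H_1(\mathrm{Conf}_n(\mathbb{C});\mathbb{Z})$ dual to the basis $\frac{1}{2\pi\sqrt{-1}}\mathrm{dlog}(x_s-x_r)$ of $H^1(\mathrm{Conf}_n(\mathbb{C});\mathbb{Z})$. The vectors $\boldsymbol{\nu}(i,j)$. For $1\le i<j\le l$ with $\mathbf{m}_i\ne\mathbf{m}_j$ let $m(i,j)=\gcd(m_{j,1}-m_{i,1},\dots,m_{j,d}-m_{i,d})$ and $\mathbf{a}=(\mathbf{m}_j-\mathbf{m}_i)/m(i,j)$. Then $\pi(H_i\cap H_j)$ has $m(i,j)$ connected components, each a hypersurface $H\in\mathscr{B}$ with $\mathbf{m}_H=\mathbf{a}$ or $\mathbf{m}_H=-\mathbf{a}$. Let $s(i,j)$ be the number of these components with $\mathbf{m}_H=\mathbf{a}$, and set $\boldsymbol{\nu}(i,j)=(\nu_1(i,j),\dots,\nu_d(i,j))=\mathbf{m}_i+(m(i,j)-s(i,j))\mathbf{a}=\mathbf{m}_j-s(i,j)\mathbf{a}\in\mathbb{Z}^d$. If $\mathbf{m}_i=\mathbf{m}_j$ (so $H_i\cap H_j=\emptyset$), set $\boldsymbol{\nu}(i,j)=\mathbf{m}_i$. *)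

theory Defs
  imports "HOL-Homology.Homology" "HOL-Complex_Analysis.Complex_Analysis"
begin

subsection \<open>Toric arrangements\<close>

text \<open>
  \<open>\<Gamma> = \<int>\<^sup>N\<close> is \<^term>\<open>free_Abelian_group {1..N}\<close>, and \<open>T = Hom(\<Gamma>, \<complex>\<^sup>\<times>)\<close> is identified with
  \<open>(\<complex>\<^sup>\<times>)\<^sup>N\<close>, whose points are the extensional functions on \<^term>\<open>{1..N}\<close> with nonzero values;
  the character \<open>\<xi>\<close> takes the value \<open>t\<^sup>\<xi>\<close> at \<open>t\<close>.
\<close>

definition torus :: "nat \<Rightarrow> (nat \<Rightarrow> complex) topology"
  where "torus N = product_topology (\<lambda>_. top_of_set (- {0})) {1..N}"

definition monomial :: "nat \<Rightarrow> (nat \<Rightarrow> int) \<Rightarrow> (nat \<Rightarrow> complex) \<Rightarrow> complex"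
  where "monomial N e t = (\<Prod>k\<in>{1..N}. t k powi e k)"

definition char_locus :: "nat \<Rightarrow> (nat \<Rightarrow>\<^sub>0 int) \<Rightarrow> (nat \<Rightarrow> complex) set"
  where "char_locus N \<xi> = {t \<in> topspace (torus N). monomial N (Poly_Mapping.lookup \<xi>) t = 1}"

abbreviation components_in :: "'a topology \<Rightarrow> 'a set \<Rightarrow> 'a set set"
  where "components_in X S \<equiv> connected_components_of (subtopology X S)"

definition presents :: "nat \<Rightarrow> (nat \<Rightarrow>\<^sub>0 int) set \<Rightarrow> (nat \<Rightarrow> complex) set set \<Rightarrow> bool"
  where "presents N \<X> \<A> \<longleftrightarrow>
    finite \<X> \<and> \<X> \<subseteq> carrier (free_Abelian_group {1..N}) - {0} \<and>
    \<A> = (\<Union>\<xi>\<in>\<X>. components_in (torus N) (char_locus N \<xi>))"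

definition toric_arrangement :: "nat \<Rightarrow> (nat \<Rightarrow> complex) set set \<Rightarrow> bool"
  where "toric_arrangement N \<A> \<longleftrightarrow> (\<exists>\<X>. presents N \<X> \<A>)"

definition complement_space :: "nat \<Rightarrow> (nat \<Rightarrow> complex) set set \<Rightarrow> (nat \<Rightarrow> complex) topology"
  where "complement_space N \<A> = subtopology (torus N) (topspace (torus N) - \<Union>\<A>)"

text \<open>
  The poset of layers depends only on the arrangement, not on the presenting set of characters:
  each locus \<^term>\<open>char_locus N \<xi>\<close> is the disjoint union of finitely many components, all of
  them members of \<open>\<A>\<close>.  Hence quantifying over all presentations yields the layers of any one of
  them.  The empty intersection is the whole torus.
\<close>

definition layers :: "nat \<Rightarrow> (nat \<Rightarrow> complex) set set \<Rightarrow> (nat \<Rightarrow> complex) set set"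
  where "layers N \<A> = {L. \<exists>\<X> S. presents N \<X> \<A> \<and> S \<subseteq> \<X> \<and>
    L \<in> components_in (torus N) (topspace (torus N) \<inter> (\<Inter>\<xi>\<in>S. char_locus N \<xi>))}"

text \<open>Layers are ordered by reverse inclusion, so a maximal layer is one minimal for inclusion.\<close>

definition essential :: "nat \<Rightarrow> (nat \<Rightarrow> complex) set set \<Rightarrow> bool"
  where "essential N \<A> \<longleftrightarrow>
    (\<forall>L\<in>layers N \<A>. (\<forall>L'\<in>layers N \<A>. L' \<subseteq> L \<longrightarrow> L' = L) \<longrightarrow> (\<exists>t. L = {t}))"

text \<open>The rank of a (finite, nonempty) poset of sets: the length of a longest chain.\<close>

definition poset_rank :: "'a set set \<Rightarrow> nat"
  where "poset_rank P = Max (card ` {C. subset.chain P C}) - 1"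


subsection \<open>Admissible subgroups and corank-one TM-ideals\<close>

definition admissible_subgroup :: "nat \<Rightarrow> (nat \<Rightarrow> complex) set \<Rightarrow> bool"
  where "admissible_subgroup N Y \<longleftrightarrow> (\<exists>\<Gamma>' \<Gamma>''.
    subgroup \<Gamma>' (free_Abelian_group {1..N}) \<and> subgroup \<Gamma>'' (free_Abelian_group {1..N}) \<and>
    \<Gamma>' <#>\<^bsub>free_Abelian_group {1..N}\<^esub> \<Gamma>'' = carrier (free_Abelian_group {1..N}) \<and>
    \<Gamma>' \<inter> \<Gamma>'' = {0} \<and>
    subgroup_generated (free_Abelian_group {1..N}) \<Gamma>' \<cong> integer_group \<and>
    Y = {t \<in> topspace (torus N). \<forall>\<xi>\<in>\<Gamma>''. monomial N (Poly_Mapping.lookup \<xi>) t = 1})"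

definition torus_coset :: "nat \<Rightarrow> (nat \<Rightarrow> complex) \<Rightarrow> (nat \<Rightarrow> complex) set \<Rightarrow> (nat \<Rightarrow> complex) set"
  where "torus_coset N t Y = (\<lambda>y. \<lambda>k\<in>{1..N}. t k * y k) ` Y"

definition sub_arrangement ::
    "nat \<Rightarrow> (nat \<Rightarrow> complex) set \<Rightarrow> (nat \<Rightarrow> complex) set set \<Rightarrow> (nat \<Rightarrow> complex) set set"
  where "sub_arrangement N Y \<A> =
    {H \<in> \<A>. \<exists>C \<subseteq> topspace (torus N). H = (\<Union>t\<in>C. torus_coset N t Y)}"

definition corank_one_TM_ideal ::
    "nat \<Rightarrow> (nat \<Rightarrow> complex) set \<Rightarrow> (nat \<Rightarrow> complex) set set \<Rightarrow> bool"
  where "corank_one_TM_ideal N Y \<A> \<longleftrightarrow>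
    admissible_subgroup N Y \<and>
    poset_rank (layers N (sub_arrangement N Y \<A>)) + 1 = poset_rank (layers N \<A>) \<and>
    (\<forall>H1 \<in> \<A> - sub_arrangement N Y \<A>. \<forall>H2 \<in> \<A> - sub_arrangement N Y \<A>. H1 \<noteq> H2 \<longrightarrow>
       (\<forall>X \<in> components_in (torus N) (H1 \<inter> H2). \<exists>H3 \<in> sub_arrangement N Y \<A>. X \<subseteq> H3)) \<and>
    (\<forall>H \<in> \<A> - sub_arrangement N Y \<A>. connectedin (torus N) (H \<inter> Y))"


subsection \<open>Coordinates and the root map\<close>

text \<open>
  A point \<open>(x, y)\<close> of \<open>(\<complex>\<^sup>\<times>)\<^sup>d\<^sup>+\<^sup>1\<close> has \<open>y\<close> as its coordinate of index \<^term>\<open>Suc d\<close>.  The quotient of the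
  torus by the last coordinate subgroup is identified with \<open>(\<complex>\<^sup>\<times>)\<^sup>d\<close> through the projection.
\<close>

definition last_coord_subgroup :: "nat \<Rightarrow> (nat \<Rightarrow> complex) set"
  where "last_coord_subgroup d = {t \<in> topspace (torus (Suc d)). \<forall>k\<in>{1..d}. t k = 1}"

definition proj :: "nat \<Rightarrow> (nat \<Rightarrow> complex) \<Rightarrow> (nat \<Rightarrow> complex)"
  where "proj d t = restrict t {1..d}"

definition quotient_arrangement :: "nat \<Rightarrow> (nat \<Rightarrow> complex) set set \<Rightarrow> (nat \<Rightarrow> complex) set set"
  where "quotient_arrangement d \<A> =
    (\<lambda>H. proj d ` H) ` sub_arrangement (Suc d) (last_coord_subgroup d) \<A>"

definition root_of_unity :: "complex \<Rightarrow> bool"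
  where "root_of_unity z \<longleftrightarrow> (\<exists>q::nat. q > 0 \<and> z ^ q = 1)"

definition Conf :: "nat \<Rightarrow> (nat \<Rightarrow> complex) topology"
  where "Conf n = subtopology (product_topology (\<lambda>_. euclidean) {1..n}) {z. inj_on z {1..n}}"

abbreviation H1_Conf :: "nat \<Rightarrow> (nat \<Rightarrow> complex) chain set monoid"
  where "H1_Conf n \<equiv> homology_group 1 (Conf n)"

definition root_map ::
    "nat \<Rightarrow> nat \<Rightarrow> (nat \<Rightarrow> complex) \<Rightarrow> (nat \<Rightarrow> nat \<Rightarrow> int) \<Rightarrow> (nat \<Rightarrow> complex) \<Rightarrow> (nat \<Rightarrow> complex)"
  where "root_map d l \<mu> m x =
    (\<lambda>r\<in>{1..Suc l}. if r = 1 then 0 else \<mu> (r - 1) * monomial d (m (r - 1)) x)"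


subsection \<open>Logarithmic forms and dual bases of first homology\<close>

text \<open>
  The integral of the closed form \<open>(1 / 2\<pi>\<i>) dlog f\<close>, for a continuous nowhere vanishing \<open>f\<close>, over
  a singular 1-simplex \<open>\<sigma>\<close> is \<open>(1 / 2\<pi>\<i>) \<integral> dz / z\<close> over the path \<open>f \<circ> \<sigma>\<close>, travelled from
  vertex 0 to vertex 1.  The winding number about 0 is precisely this integral, extended to
  paths that are merely continuous; the path need not be closed, in which case the value
  need not be an integer.
\<close>

definition dlog_simplex :: "('a \<Rightarrow> complex) \<Rightarrow> ((nat \<Rightarrow> real) \<Rightarrow> 'a) \<Rightarrow> complex"
  where "dlog_simplex f \<sigma> =
    winding_number (\<lambda>s. f (\<sigma> (\<lambda>i. if i = 0 then 1 - s else if i = 1 then s else 0))) 0"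

definition dlog_chain :: "('a \<Rightarrow> complex) \<Rightarrow> 'a chain \<Rightarrow> complex"
  where "dlog_chain f c =
    (\<Sum>\<sigma>\<in>Poly_Mapping.keys c. of_int (Poly_Mapping.lookup c \<sigma>) * dlog_simplex f \<sigma>)"

text \<open>A homology class is a coset of cycles; any representative gives the same value.\<close>

definition dlog_pairing :: "('a \<Rightarrow> complex) \<Rightarrow> 'a chain set \<Rightarrow> complex"
  where "dlog_pairing f \<gamma> = dlog_chain f (SOME c. c \<in> \<gamma>)"

text \<open>
  The family \<open>\<gamma>\<close>, indexed by \<open>I\<close>, is a \<open>\<int>\<close>-basis of \<open>H\<^sub>1(X; \<int>)\<close> (written multiplicatively) and is
  dual to the classes of the forms \<open>(1 / 2\<pi>\<i>) dlog (f i)\<close>.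
\<close>

definition dual_basis_H1 ::
    "'a topology \<Rightarrow> 'i set \<Rightarrow> ('i \<Rightarrow> 'a \<Rightarrow> complex) \<Rightarrow> ('i \<Rightarrow> 'a chain set) \<Rightarrow> bool"
  where "dual_basis_H1 X I f \<gamma> \<longleftrightarrow>
    (\<forall>i\<in>I. \<gamma> i \<in> carrier (homology_group 1 X)) \<and>
    (\<forall>h\<in>carrier (homology_group 1 X). \<exists>!c. c \<in> I \<rightarrow>\<^sub>E (UNIV :: int set) \<and>
       h = (\<Otimes>\<^bsub>homology_group 1 X\<^esub>i\<in>I. \<gamma> i [^]\<^bsub>homology_group 1 X\<^esub> c i)) \<and>
    (\<forall>i\<in>I. \<forall>j\<in>I. dlog_pairing (f i) (\<gamma> j) = (if i = j then 1 else 0))"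


subsection \<open>The vectors \<open>\<nu>(i, j)\<close>\<close>

text \<open>Vectors of \<open>\<int>\<^sup>d\<close> are functions of which only the values on \<^term>\<open>{1..d}\<close> matter.\<close>

definition gcd_diff :: "nat \<Rightarrow> (nat \<Rightarrow> nat \<Rightarrow> int) \<Rightarrow> nat \<Rightarrow> nat \<Rightarrow> int"
  where "gcd_diff d m i j = Gcd ((\<lambda>k. m j k - m i k) ` {1..d})"

definition prim_dir :: "nat \<Rightarrow> (nat \<Rightarrow> nat \<Rightarrow> int) \<Rightarrow> nat \<Rightarrow> nat \<Rightarrow> nat \<Rightarrow> int"
  where "prim_dir d m i j k = (m j k - m i k) div gcd_diff d m i j"

definition meet_components ::
    "nat \<Rightarrow> (nat \<Rightarrow> (nat \<Rightarrow> complex) set) \<Rightarrow> nat \<Rightarrow> nat \<Rightarrow> (nat \<Rightarrow> complex) set set"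
  where "meet_components d Hs i j = components_in (torus d) (proj d ` (Hs i \<inter> Hs j))"

definition pos_count ::
    "nat \<Rightarrow> (nat \<Rightarrow> (nat \<Rightarrow> complex) set) \<Rightarrow> (nat \<Rightarrow> nat \<Rightarrow> int) \<Rightarrow>
     ((nat \<Rightarrow> complex) set \<Rightarrow> nat \<Rightarrow> int) \<Rightarrow> nat \<Rightarrow> nat \<Rightarrow> nat"
  where "pos_count d Hs m mH i j =
    card {H \<in> meet_components d Hs i j. \<forall>k\<in>{1..d}. mH H k = prim_dir d m i j k}"

definition nu ::
    "nat \<Rightarrow> (nat \<Rightarrow> (nat \<Rightarrow> complex) set) \<Rightarrow> (nat \<Rightarrow> nat \<Rightarrow> int) \<Rightarrow>
     ((nat \<Rightarrow> complex) set \<Rightarrow> nat \<Rightarrow> int) \<Rightarrow> nat \<Rightarrow> nat \<Rightarrow> nat \<Rightarrow> int"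
  where "nu d Hs m mH i j k =
    (if \<forall>k\<in>{1..d}. m i k = m j k then m i k
     else m i k + (gcd_diff d m i j - int (pos_count d Hs m mH i j)) * prim_dir d m i j k)"

end

theory Submission
  imports Defs "HOL-Computational_Algebra.Fundamental_Theorem_Algebra"
begin

text \<open>
  Integrating \<open>(1 / 2\<pi>\<i>) dlog f\<close> for a nowhere vanishing \<open>f\<close> kills boundaries, is natural and turns
  products of functions into sums.  A class in \<open>H\<^sub>1\<close> of the configuration space is therefore
  determined by its pairings with the functions \<open>z\<^sub>s - z\<^sub>r\<close>, and these pull back under the root map
  to the roots \<open>\<mu>\<^sub>j x\<^bsup>m\<^sub>j\<^esup>\<close> and to their differences.  A difference of roots factors as a constant times
  \<open>x\<^bsup>\<nu>(i, j)\<^esup>\<close> times the product of the equations \<open>f\<^sub>H\<close> over the components \<open>H\<close> of \<open>\<pi>(H\<^sub>i \<inter> H\<^sub>j)\<close>, all of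
  which belong to \<open>\<B>\<close> by the TM-ideal condition, so its pairings with the dual basis can be read off.
\<close>

text \<open>Singular simplices are merely continuous, so every rule for the integrals is derived by
  lifting \<open>f\<close> along a simplex to a continuous logarithm; the difference of its end
  values gives the winding number even when the path is not closed. A second difficulty is the
  choice of equations: a hypersurface determines its primitive exponent only up to sign, and
  \<open>mH\<close> is an arbitrary choice. A factor \<open>x^a - \<rho>\<close> of a root
  difference is therefore either the chosen equation itself or, by
  \<open>x^a - \<rho> = - \<rho> * x^a * (x^(-a) - 1/\<rho>)\<close>, that equation times a constant
  and a spare monomial \<open>x^a\<close>. Counting the spare monomials is what produces
  \<open>nu\<close>. Finally, the TM-ideal condition only puts a component inside some member of
  \<open>\<B>\<close>. That the component is itself a member comes from rigidity: for primitive
  exponents, containment of level sets forces equality.\<close>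

declare One_nat_def [simp del]

subsection \<open>Integrals of logarithmic forms over singular chains\<close>

abbreviation nonvanishing_map :: "'a topology \<Rightarrow> ('a \<Rightarrow> complex) \<Rightarrow> bool"
  where "nonvanishing_map X f \<equiv> continuous_map X (top_of_set (- {0})) f"

lemma nonvanishing_map_iff:
  "nonvanishing_map X f \<longleftrightarrow> continuous_map X euclidean f \<and> (\<forall>x\<in>topspace X. f x \<noteq> 0)"
  by (auto simp: continuous_map_in_subtopology image_subset_iff)

lemma nonvanishing_map_mult:
  "nonvanishing_map X f \<Longrightarrow> nonvanishing_map X g \<Longrightarrow> nonvanishing_map X (\<lambda>x. f x * g x)"
  unfolding nonvanishing_map_iff by (auto simp: continuous_map_atin intro: tendsto_mult)

lemma nonvanishing_map_prod:
  assumes "\<And>i. i \<in> I \<Longrightarrow> nonvanishing_map X (f i)"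
  shows "nonvanishing_map X (\<lambda>x. \<Prod>i\<in>I. f i x)"
  using assms
  by (induction I rule: infinite_finite_induct)
    (auto intro!: nonvanishing_map_mult)

lemma nonvanishing_map_power_int:
  "nonvanishing_map X f \<Longrightarrow> nonvanishing_map X (\<lambda>x. f x powi e)"
  unfolding nonvanishing_map_iff by (auto simp: continuous_map_atin intro!: tendsto_power_int)

lemma nonvanishing_map_const: "c \<noteq> 0 \<Longrightarrow> nonvanishing_map X (\<lambda>_. c)"
  by auto

section \<open>Continuous logarithms along 1-simplices\<close>

definition edge :: "real \<Rightarrow> nat \<Rightarrow> real"
  where "edge s = (\<lambda>i. if i = 0 then 1 - s else if i = 1 then s else 0)"

lemma edge_in_standard_simplex: "s \<in> {0..1} \<Longrightarrow> edge s \<in> standard_simplex 1"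
  by (auto simp: edge_def standard_simplex_def One_nat_def)

lemma dlog_simplex_edge: "dlog_simplex f \<sigma> = winding_number (\<lambda>s. f (\<sigma> (edge s))) 0"
  by (simp add: dlog_simplex_def edge_def)

lemma continuous_map_edge:
  "continuous_map (top_of_set {0..1}) (subtopology (powertop_real UNIV) (standard_simplex 1)) edge"
proof -
  have "continuous_map (top_of_set {0..1::real}) euclideanreal (\<lambda>s. edge s i)" for i
    unfolding edge_def continuous_map_iff_continuous2
    by (cases "i = 0"; cases "i = 1") (auto intro!: continuous_intros)
  then show ?thesis
    using edge_in_standard_simplex
    by (auto simp: continuous_map_in_subtopology continuous_map_componentwise_UNIV)
qed

text \<open>The winding number of \<open>exp \<circ> q\<close> about 0 is the increment of
  \<open>q\<close> divided by 2 pi i, closed path or not. All later rules reduce to this formula by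
  exhibiting a suitable \<open>q\<close>.\<close>

lemma dlog_simplex_exp:
  assumes "path q" "\<And>s. s \<in> {0..1} \<Longrightarrow> f (\<sigma> (edge s)) = exp (q s)"
  shows "dlog_simplex f \<sigma> = (q 1 - q 0) / (2 * of_real pi * \<i>)"
proof -
  have "dlog_simplex f \<sigma> = winding_number (exp \<circ> q) 0"
    unfolding dlog_simplex_edge by (rule winding_number_cong) (use assms in auto)
  then show ?thesis
    using winding_number_compose_exp[OF assms(1)] by (simp add: pathfinish_def pathstart_def)
qed

text \<open>A path in the punctured plane lifts through the exponential.\<close>

lemma singular_simplex_log:
  assumes "nonvanishing_map X f" "singular_simplex 1 X \<sigma>"
  obtains q where "path q" "\<And>s. s \<in> {0..1} \<Longrightarrow> f (\<sigma> (edge s)) = exp (q s)"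
proof -
  have "continuous_map (top_of_set {0..1}) (top_of_set (- {0})) (f \<circ> (\<sigma> \<circ> edge))"
    using assms unfolding singular_simplex_def
    by (blast intro: continuous_map_compose continuous_map_edge)
  then have "path (f \<circ> (\<sigma> \<circ> edge))" "0 \<notin> path_image (f \<circ> (\<sigma> \<circ> edge))"
    by (auto simp: path_def path_image_def continuous_map_in_subtopology image_subset_iff)
  then obtain q where "path q" "\<And>t. t \<in> {0..1} \<Longrightarrow> (f \<circ> (\<sigma> \<circ> edge)) t = 0 + exp (q t)"
    by (metis winding_number_as_continuous_log)
  then show thesis
    using that by auto
qed

text \<open>Logarithms of the factors add up to a logarithm of the product, chosen continuously
  along the whole edge, so no integer ambiguity enters.\<close>

lemma dlog_simplex_mult:
  assumes "nonvanishing_map X f" "nonvanishing_map X g" "singular_simplex 1 X \<sigma>"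
  shows "dlog_simplex (\<lambda>x. f x * g x) \<sigma> = dlog_simplex f \<sigma> + dlog_simplex g \<sigma>"
proof -
  obtain p where p: "path p" "\<And>s. s \<in> {0..1} \<Longrightarrow> f (\<sigma> (edge s)) = exp (p s)"
    using singular_simplex_log assms by metis
  obtain q where q: "path q" "\<And>s. s \<in> {0..1} \<Longrightarrow> g (\<sigma> (edge s)) = exp (q s)"
    using singular_simplex_log assms by metis
  have "path (\<lambda>s. p s + q s)"
    using p q by (auto simp: path_def intro: continuous_intros)
  then have "dlog_simplex (\<lambda>x. f x * g x) \<sigma> = ((p 1 + q 1) - (p 0 + q 0)) / (2 * of_real pi * \<i>)"
    by (rule dlog_simplex_exp) (simp add: p q exp_add)
  then show ?thesis
    using dlog_simplex_exp[of p f \<sigma>] dlog_simplex_exp[of q g \<sigma>] p q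
    by (simp flip: add_divide_distrib)
qed

lemma dlog_simplex_power_int:
  assumes "nonvanishing_map X f" "singular_simplex 1 X \<sigma>"
  shows "dlog_simplex (\<lambda>x. f x powi e) \<sigma> = of_int e * dlog_simplex f \<sigma>"
proof -
  obtain p where p: "path p" "\<And>s. s \<in> {0..1} \<Longrightarrow> f (\<sigma> (edge s)) = exp (p s)"
    using singular_simplex_log assms by metis
  have "path (\<lambda>s. of_int e * p s)"
    using p by (auto simp: path_def intro: continuous_intros)
  then have "dlog_simplex (\<lambda>x. f x powi e) \<sigma>
      = (of_int e * p 1 - of_int e * p 0) / (2 * of_real pi * \<i>)"
    by (rule dlog_simplex_exp) (simp add: p exp_power_int mult.commute)
  then show ?thesis
    using dlog_simplex_exp[of p f \<sigma>] p by (simp flip: right_diff_distrib)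
qed

lemma dlog_simplex_const: "c \<noteq> 0 \<Longrightarrow> dlog_simplex (\<lambda>_. c) \<sigma> = 0"
  unfolding dlog_simplex_def by (rule winding_number_constI) auto

lemma dlog_simplex_cong:
  assumes "\<And>x. x \<in> topspace X \<Longrightarrow> f x = g x" "singular_simplex 1 X \<sigma>"
  shows "dlog_simplex f \<sigma> = dlog_simplex g \<sigma>"
proof -
  have "\<sigma> (edge s) \<in> topspace X" if "s \<in> {0..1}" for s
    using assms(2) edge_in_standard_simplex[OF that]
    unfolding singular_simplex_def continuous_map_def by auto
  then show ?thesis
    unfolding dlog_simplex_edge using assms(1) by (intro winding_number_cong) auto
qed

section \<open>Extension to chains by linearity, and vanishing on boundaries\<close>

lemma dlog_chain_eq_sum:
  assumes "finite S" "Poly_Mapping.keys c \<subseteq> S"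
  shows "dlog_chain f c = (\<Sum>\<sigma>\<in>S. of_int (Poly_Mapping.lookup c \<sigma>) * dlog_simplex f \<sigma>)"
  unfolding dlog_chain_def
  by (rule sum.mono_neutral_left) (use assms in \<open>auto simp: in_keys_iff\<close>)

lemma dlog_chain_0 [simp]: "dlog_chain f 0 = 0"
  by (simp add: dlog_chain_def)

lemma dlog_chain_frag_of [simp]: "dlog_chain f (frag_of \<sigma>) = dlog_simplex f \<sigma>"
  by (simp add: dlog_chain_def)

lemma dlog_chain_add: "dlog_chain f (a + b) = dlog_chain f a + dlog_chain f b"
proof -
  let ?S = "Poly_Mapping.keys a \<union> Poly_Mapping.keys b"
  have "Poly_Mapping.keys (a + b) \<subseteq> ?S"
    by (rule Poly_Mapping.keys_add)
  then show ?thesis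
    using dlog_chain_eq_sum[of ?S]
    by (simp add: lookup_add distrib_right sum.distrib)
qed

lemma dlog_chain_minus: "dlog_chain f (- a) = - dlog_chain f a"
  using dlog_chain_add[of f a "- a"] by (simp add: add_eq_0_iff)

lemma dlog_chain_diff: "dlog_chain f (a - b) = dlog_chain f a - dlog_chain f b"
  using dlog_chain_add[of f a "- b"] by (simp add: dlog_chain_minus)

lemma dlog_chain_mult:
  assumes "nonvanishing_map X f" "nonvanishing_map X g" "singular_chain 1 X c"
  shows "dlog_chain (\<lambda>x. f x * g x) c = dlog_chain f c + dlog_chain g c"
  using assms(3) unfolding dlog_chain_def singular_chain_def
  by (simp add: sum.distrib[symmetric] distrib_left[symmetric] subset_iff
      dlog_simplex_mult[OF assms(1,2)])

lemma dlog_chain_power_int: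
  assumes "nonvanishing_map X f" "singular_chain 1 X c"
  shows "dlog_chain (\<lambda>x. f x powi e) c = of_int e * dlog_chain f c"
  using assms(2) unfolding dlog_chain_def singular_chain_def
  by (simp add: sum_distrib_left subset_iff dlog_simplex_power_int[OF assms(1)] mult.left_commute)

lemma dlog_chain_const: "c \<noteq> 0 \<Longrightarrow> dlog_chain (\<lambda>_. c) b = 0"
  by (simp add: dlog_chain_def dlog_simplex_const)

lemma dlog_chain_prod:
  assumes "\<And>i. i \<in> I \<Longrightarrow> nonvanishing_map X (f i)" "singular_chain 1 X c"
  shows "dlog_chain (\<lambda>x. \<Prod>i\<in>I. f i x) c = (\<Sum>i\<in>I. dlog_chain (f i) c)"
  using assms
proof (induction I rule: infinite_finite_induct)
  case (insert i I)
  then show ?case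
    by (simp add: dlog_chain_mult[where X = X] nonvanishing_map_prod)
\<comment> \<open>For infinite \<open>I\<close> the product is by convention the constant 1 and the
  sum is 0, exactly as for the empty index set.\<close>
qed (auto simp: dlog_chain_const)

lemma dlog_chain_cong:
  assumes "\<And>x. x \<in> topspace X \<Longrightarrow> f x = g x" "singular_chain 1 X c"
  shows "dlog_chain f c = dlog_chain g c"
  using assms(2) unfolding dlog_chain_def singular_chain_def
  by (intro sum.cong) (auto simp: dlog_simplex_cong[OF assms(1)])

lemma dlog_chain_chain_map: "dlog_chain f (chain_map 1 b c) = dlog_chain (f \<circ> b) c"
proof -
  have *: "dlog_simplex f (simplex_map 1 b \<sigma>) = dlog_simplex (f \<circ> b) \<sigma>" for \<sigma>
    \<comment> \<open>\<open>simplex_map\<close> restricts the composite to the standard simplex, so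
      the two paths agree only on the unit interval, which is all a winding number sees.\<close>
    unfolding dlog_simplex_edge simplex_map_def
    by (rule winding_number_cong) (use edge_in_standard_simplex in auto)
  have "Poly_Mapping.keys c \<subseteq> UNIV"
    by simp
  then show ?thesis
    by (induction c rule: frag_induction)
      (simp_all add: * chain_map_diff dlog_chain_diff del: o_apply)
qed

text \<open>A continuous logarithm of \<open>f\<close> exists on the whole triangle, so the three edges telescope.\<close>

lemma dlog_chain_boundary_simplex:
  assumes f: "nonvanishing_map X f" and \<sigma>: "singular_simplex 2 X \<sigma>"
  shows "dlog_chain f (chain_boundary 2 (frag_of \<sigma>)) = 0"
proof -
  \<comment> \<open>\<open>T\<close> is a copy in the plane of the standard 2-simplex, which itself
    lives in a function space. \<open>Re z\<close> and \<open>Im z\<close> are the barycentric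
    coordinates at vertices 1 and 2; being convex, \<open>T\<close> is contractible and admits a
    logarithm.\<close>
  define T where "T = {z :: complex. 0 \<le> Re z \<and> 0 \<le> Im z \<and> Re z + Im z \<le> 1}"
  define v where "v z i = (if i = 0 then 1 - Re z - Im z else if i = 1 then Re z
    else if i = 2 then Im z else 0)" for z and i :: nat
  have v_in: "v z \<in> standard_simplex 2" if "z \<in> T" for z
    using that by (auto simp: T_def v_def standard_simplex_def numeral_2_eq_2)
  have "continuous_map (top_of_set T) euclideanreal (\<lambda>z. v z i)" for i
    unfolding v_def continuous_map_iff_continuous2
    by (cases "i = 0"; cases "i = 1"; cases "i = 2") (auto intro!: continuous_intros)
  then have cont_v: "continuous_map (top_of_set T)
      (subtopology (powertop_real UNIV) (standard_simplex 2)) v"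
    using v_in by (auto simp: continuous_map_in_subtopology continuous_map_componentwise_UNIV)
  have "continuous_map (top_of_set T) (top_of_set (- {0})) (f \<circ> (\<sigma> \<circ> v))"
    using f \<sigma> cont_v unfolding singular_simplex_def by (blast intro: continuous_map_compose)
  then have "continuous_on T (f \<circ> (\<sigma> \<circ> v))" "\<And>z. z \<in> T \<Longrightarrow> (f \<circ> (\<sigma> \<circ> v)) z \<noteq> 0"
    by (auto simp: continuous_map_in_subtopology image_subset_iff)
  moreover have "convex T"
  proof -
    have "T = {z. Re z \<ge> 0} \<inter> {z. Im z \<ge> 0} \<inter> {z. (1 + \<i>) \<bullet> z \<le> 1}"
      by (auto simp: T_def inner_complex_def)
    then show ?thesis
      by (simp add: convex_Int convex_halfspace_Re_ge convex_halfspace_Im_ge convex_halfspace_le)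
  qed
  ultimately obtain L where "continuous_on T L"
      "\<And>z. z \<in> T \<Longrightarrow> (f \<circ> (\<sigma> \<circ> v)) z = exp (L z)"
    using continuous_logarithm_on_contractible[of T "f \<circ> (\<sigma> \<circ> v)"] convex_imp_contractible
    by blast
  then have L: "continuous_on T L" "\<And>z. z \<in> T \<Longrightarrow> f (\<sigma> (v z)) = exp (L z)"
    by auto
  have face: "dlog_simplex f (singular_face 2 k \<sigma>) = (L (\<gamma> 1) - L (\<gamma> 0)) / (2 * of_real pi * \<i>)"
    if "continuous_on {0..1} \<gamma>" "\<And>s. s \<in> {0..1} \<Longrightarrow> \<gamma> s \<in> T"
      "\<And>s. s \<in> {0..1} \<Longrightarrow> simplical_face k (edge s) = v (\<gamma> s)" for k \<gamma>
  proof -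
    have "path (L \<circ> \<gamma>)"
      unfolding path_def using that L(1)
      by (intro continuous_on_compose) (auto intro: continuous_on_subset)
    then have "dlog_simplex f (singular_face 2 k \<sigma>)
        = ((L \<circ> \<gamma>) 1 - (L \<circ> \<gamma>) 0) / (2 * of_real pi * \<i>)"
      by (rule dlog_simplex_exp)
        (use that L(2) edge_in_standard_simplex in \<open>auto simp: singular_face_def\<close>)
    then show ?thesis
      by simp
  qed
  have nat_cases: "i = 0 \<or> i = 1 \<or> i = 2 \<or> i > 2" for i :: nat
    by linarith
  \<comment> \<open>Face \<open>k\<close> omits vertex \<open>k\<close>, and the vertices 0, 1, 2
    sit at 0, 1 and the imaginary unit. The terms \<open>1 - 1\<close> and \<open>1 - 0\<close> stay
    unsimplified to match \<open>face\<close> with the path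
    \<open>Complex (1 - s) s\<close>.\<close>
  have "dlog_simplex f (singular_face 2 0 \<sigma>)
      = (L (Complex (1 - 1) 1) - L (Complex (1 - 0) 0)) / (2 * of_real pi * \<i>)"
  proof (rule face)
    show "simplical_face 0 (edge s) = v (Complex (1 - s) s)" for s
    proof
      show "simplical_face 0 (edge s) i = v (Complex (1 - s) s) i" for i
        using nat_cases[of i] by (auto simp: edge_def simplical_face_def v_def)
    qed
  qed (auto simp: T_def Complex_eq intro!: continuous_intros)
  moreover have "dlog_simplex f (singular_face 2 1 \<sigma>)
      = (L (Complex 0 1) - L (Complex 0 0)) / (2 * of_real pi * \<i>)"
  proof (rule face)
    show "simplical_face 1 (edge s) = v (Complex 0 s)" for s
    proof
      show "simplical_face 1 (edge s) i = v (Complex 0 s) i" for i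
        using nat_cases[of i] by (auto simp: edge_def simplical_face_def v_def)
    qed
  qed (auto simp: T_def Complex_eq intro!: continuous_intros)
  moreover have "dlog_simplex f (singular_face 2 2 \<sigma>)
      = (L (Complex 1 0) - L (Complex 0 0)) / (2 * of_real pi * \<i>)"
  proof (rule face)
    show "simplical_face 2 (edge s) = v (Complex s 0)" for s
    proof
      show "simplical_face 2 (edge s) i = v (Complex s 0) i" for i
        using nat_cases[of i] by (auto simp: edge_def simplical_face_def v_def)
    qed
  qed (auto simp: T_def Complex_eq intro!: continuous_intros)
  ultimately show ?thesis
    by (simp add: chain_boundary_of atMost_Suc dlog_chain_add dlog_chain_diff
        dlog_chain_minus diff_divide_distrib numeral_2_eq_2 One_nat_def)
qed

lemma dlog_chain_boundary:
  assumes f: "nonvanishing_map X f" and c: "singular_relboundary 1 X {} c"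
  shows "dlog_chain f c = 0"
proof -
  obtain b where b: "singular_chain 2 X b" "chain_boundary 2 b = c"
    using c by (auto simp: singular_boundary numeral_2_eq_2)
  have "dlog_chain f (chain_boundary 2 b) = 0"
    using b(1)[unfolded singular_chain_def]
    by (induction b rule: frag_induction)
      (simp_all add: chain_boundary_diff dlog_chain_diff dlog_chain_boundary_simplex[OF f])
  then show ?thesis
    using b by simp
qed


subsection \<open>The pairing of logarithmic forms with first homology\<close>

lemma carrier_homology_group_1:
  "carrier (homology_group 1 X) = homologous_rel_set 1 X {} ` singular_relcycle_set 1 X {}"
  using carrier_relative_homology_group[of 1 X "{}"] by simp

text \<open>The representative picked by \<open>SOME\<close> differs from \<open>c\<close> by a
  boundary, on which the integral vanishes; this makes the choice in \<open>dlog_pairing\<close>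
  harmless.\<close>

lemma dlog_pairing_homologous:
  assumes "nonvanishing_map X f"
  shows "dlog_pairing f (homologous_rel_set 1 X {} c) = dlog_chain f c"
proof -
  have "(SOME b. b \<in> homologous_rel_set 1 X {} c) \<in> homologous_rel_set 1 X {} c"
    by (rule someI[of _ c]) simp
  then have "singular_relboundary 1 X {} (c - (SOME b. b \<in> homologous_rel_set 1 X {} c))"
    by (simp add: homologous_rel_def)
  then show ?thesis
    using dlog_chain_boundary[OF assms] by (fastforce simp: dlog_pairing_def dlog_chain_diff)
qed

lemma homology_class_1_cases:
  assumes "\<gamma> \<in> carrier (homology_group 1 X)"
  obtains c where "singular_relcycle 1 X {} c" "singular_chain 1 X c"
    "\<gamma> = homologous_rel_set 1 X {} c"
  using assms that by (auto simp: carrier_homology_group_1 singular_relcycle)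

lemma dlog_pairing_prod:
  assumes "\<And>i. i \<in> I \<Longrightarrow> nonvanishing_map X (f i)" "\<gamma> \<in> carrier (homology_group 1 X)"
  shows "dlog_pairing (\<lambda>x. \<Prod>i\<in>I. f i x) \<gamma> = (\<Sum>i\<in>I. dlog_pairing (f i) \<gamma>)"
  using assms
  by (elim homology_class_1_cases)
    (auto simp: dlog_pairing_homologous[where X = X] nonvanishing_map_prod
      dlog_chain_prod[where X = X])

lemma dlog_pairing_mult:
  assumes "nonvanishing_map X f" "nonvanishing_map X g" "\<gamma> \<in> carrier (homology_group 1 X)"
  shows "dlog_pairing (\<lambda>x. f x * g x) \<gamma> = dlog_pairing f \<gamma> + dlog_pairing g \<gamma>"
  using assms
  by (elim homology_class_1_cases)
    (auto simp: dlog_pairing_homologous[where X = X] nonvanishing_map_mult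
      dlog_chain_mult[where X = X])

lemma dlog_pairing_power_int:
  assumes "nonvanishing_map X f" "\<gamma> \<in> carrier (homology_group 1 X)"
  shows "dlog_pairing (\<lambda>x. f x powi e) \<gamma> = of_int e * dlog_pairing f \<gamma>"
  using assms
  by (elim homology_class_1_cases)
    (auto simp: dlog_pairing_homologous[where X = X] nonvanishing_map_power_int
      dlog_chain_power_int[where X = X])

lemma dlog_pairing_const:
  assumes "c \<noteq> 0"
  shows "dlog_pairing (\<lambda>_. c) \<gamma> = 0"
  using assms by (simp add: dlog_pairing_def dlog_chain_const)

text \<open>Both sides integrate over the same chosen representative, and it is a chain in
  \<open>X\<close>, so values of the functions off \<open>topspace X\<close> never matter.\<close>

lemma dlog_pairing_cong:
  assumes "\<And>x. x \<in> topspace X \<Longrightarrow> f x = g x" "\<gamma> \<in> carrier (homology_group 1 X)"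
  shows "dlog_pairing f \<gamma> = dlog_pairing g \<gamma>"
proof -
  obtain c where c: "singular_chain 1 X c" "\<gamma> = homologous_rel_set 1 X {} c"
    using assms(2) homology_class_1_cases by metis
  have "(SOME b. b \<in> \<gamma>) \<in> \<gamma>"
    unfolding c by (rule someI[of _ c]) simp
  then have "singular_chain 1 X (SOME b. b \<in> \<gamma>)"
    using c homologous_rel_singular_chain by fastforce
  then show ?thesis
    unfolding dlog_pairing_def by (intro dlog_chain_cong[where X = X] assms(1))
qed

lemma dlog_pairing_hom_induced:
  assumes b: "continuous_map X Y b" and f: "nonvanishing_map Y f"
    and "\<gamma> \<in> carrier (homology_group 1 X)"
  shows "dlog_pairing f (hom_induced 1 X {} Y {} b \<gamma>) = dlog_pairing (f \<circ> b) \<gamma>"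
proof -
  obtain c where c: "singular_relcycle 1 X {} c" "\<gamma> = homologous_rel_set 1 X {} c"
    using assms(3) homology_class_1_cases by metis
  have "hom_induced 1 X {} Y {} b \<gamma> = homologous_rel_set 1 Y {} (chain_map 1 b c)"
    using hom_induced_chain_map[of X Y b "{}" "{}" 1 c] b c by simp
  moreover have "nonvanishing_map X (f \<circ> b)"
    using b f by (rule continuous_map_compose)
  ultimately show ?thesis
    by (simp add: c(2) dlog_pairing_homologous[OF f] dlog_pairing_homologous[of X "f \<circ> b"]
        dlog_chain_chain_map del: o_apply)
qed

section \<open>The pairing as a homomorphism, and recognition of classes by a dual basis\<close>

lemma comm_group_homology_group_1: "comm_group (homology_group 1 X)"
  using abelian_relative_homology_group by blast

lemma dlog_pairing_group_mult:
  assumes f: "nonvanishing_map X f"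
    and "\<alpha> \<in> carrier (homology_group 1 X)" "\<beta> \<in> carrier (homology_group 1 X)"
  shows "dlog_pairing f (\<alpha> \<otimes>\<^bsub>homology_group 1 X\<^esub> \<beta>) = dlog_pairing f \<alpha> + dlog_pairing f \<beta>"
proof -
  interpret comm_group "homology_group 1 X"
    by (rule comm_group_homology_group_1)
  obtain a where a: "singular_relcycle 1 X {} a" "\<alpha> = homologous_rel_set 1 X {} a"
    using assms homology_class_1_cases by metis
  obtain b where b: "singular_relcycle 1 X {} b" "\<beta> = homologous_rel_set 1 X {} b"
    using assms homology_class_1_cases by metis
  obtain c where c: "\<alpha> \<otimes>\<^bsub>homology_group 1 X\<^esub> \<beta> = homologous_rel_set 1 X {} c"
    using m_closed[OF assms(2,3)] homology_class_1_cases by metis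
  \<comment> \<open>The product of two classes is the sum of the cosets as sets, so the sum of
    representatives represents it.\<close>
  have "a + b \<in> \<alpha> \<otimes>\<^bsub>homology_group 1 X\<^esub> \<beta>"
    using mult_relative_homology_group[of 1 X "{}"] a b by force
  then have "homologous_rel_set 1 X {} c = homologous_rel_set 1 X {} (a + b)"
    by (simp add: c homologous_rel_set_eq)
  then have "dlog_pairing f (\<alpha> \<otimes>\<^bsub>homology_group 1 X\<^esub> \<beta>) = dlog_chain f (a + b)"
    by (simp only: c dlog_pairing_homologous[OF f])
  then show ?thesis
    by (simp only: a b dlog_pairing_homologous[OF f] dlog_chain_add)
qed

lemma dlog_pairing_group_one:
  assumes "nonvanishing_map X f"
  shows "dlog_pairing f \<one>\<^bsub>homology_group 1 X\<^esub> = 0"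
proof -
  interpret comm_group "homology_group 1 X"
    by (rule comm_group_homology_group_1)
  show ?thesis
    using dlog_pairing_group_mult[OF assms one_closed one_closed] by simp
qed

lemma dlog_pairing_group_int_pow:
  assumes f: "nonvanishing_map X f" and \<gamma>: "\<gamma> \<in> carrier (homology_group 1 X)"
  shows "dlog_pairing f (\<gamma> [^]\<^bsub>homology_group 1 X\<^esub> (e :: int)) = of_int e * dlog_pairing f \<gamma>"
proof -
  interpret comm_group "homology_group 1 X"
    by (rule comm_group_homology_group_1)
  show ?thesis
  proof (induction e rule: int_induct[where k = 0])
    case base
    show ?case
      by (simp add: dlog_pairing_group_one[OF f])
  next
    case (step1 e)
    then show ?case
      using \<gamma> by (simp add: int_pow_mult dlog_pairing_group_mult[OF f] int_pow_1 distrib_right)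
  next
    case (step2 e)
    have "\<gamma> [^]\<^bsub>homology_group 1 X\<^esub> (e - 1) \<otimes>\<^bsub>homology_group 1 X\<^esub> \<gamma> = \<gamma> [^]\<^bsub>homology_group 1 X\<^esub> e"
      using int_pow_mult[OF \<gamma>, of "e - 1" 1] \<gamma> by (simp add: int_pow_1)
    then show ?case
      using dlog_pairing_group_mult[OF f int_pow_closed[OF \<gamma>] \<gamma>, of "e - 1"] step2
      by (simp add: algebra_simps)
  qed
qed

lemma dlog_pairing_finprod:
  assumes f: "nonvanishing_map X f" and "finite I"
    and "\<And>i. i \<in> I \<Longrightarrow> \<gamma> i \<in> carrier (homology_group 1 X)"
  shows "dlog_pairing f (\<Otimes>\<^bsub>homology_group 1 X\<^esub>i\<in>I. \<gamma> i) = (\<Sum>i\<in>I. dlog_pairing f (\<gamma> i))"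
proof -
  interpret comm_group "homology_group 1 X"
    by (rule comm_group_homology_group_1)
  show ?thesis
    using assms(2,3)
  proof (induction I rule: finite_induct)
    case empty
    show ?case
      by (simp add: dlog_pairing_group_one[OF f])
  next
    case (insert i I)
    then show ?case
      by (subst finprod_insert) (auto simp: Pi_def dlog_pairing_group_mult[OF f])
  qed
qed

lemma dual_basis_H1_closed:
  "dual_basis_H1 X I f \<gamma> \<Longrightarrow> i \<in> I \<Longrightarrow> \<gamma> i \<in> carrier (homology_group 1 X)"
  by (simp add: dual_basis_H1_def)

lemma dual_basis_H1_pairing:
  "dual_basis_H1 X I f \<gamma> \<Longrightarrow> i \<in> I \<Longrightarrow> j \<in> I \<Longrightarrow>
    dlog_pairing (f i) (\<gamma> j) = (if i = j then 1 else 0)"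
  by (simp add: dual_basis_H1_def)

text \<open>When a class is expanded in the basis \<open>\<gamma>\<close>, duality makes its pairing
  with \<open>f j\<close> equal to the coefficient of \<open>\<gamma> j\<close>. The pairings thus
  recover all coefficients.\<close>

lemma dual_basis_H1_eqI:
  assumes basis: "dual_basis_H1 X I f \<gamma>" and "finite I"
    and f: "\<And>i. i \<in> I \<Longrightarrow> nonvanishing_map X (f i)"
    and \<alpha>: "\<alpha> \<in> carrier (homology_group 1 X)" and \<beta>: "\<beta> \<in> carrier (homology_group 1 X)"
    and eq: "\<And>i. i \<in> I \<Longrightarrow> dlog_pairing (f i) \<alpha> = dlog_pairing (f i) \<beta>"
  shows "\<alpha> = \<beta>"
proof -
  interpret comm_group "homology_group 1 X"
    by (rule comm_group_homology_group_1)
  let ?P = "\<lambda>c. \<Otimes>\<^bsub>homology_group 1 X\<^esub>i\<in>I. \<gamma> i [^]\<^bsub>homology_group 1 X\<^esub> (c i :: int)"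
  have \<gamma>: "\<gamma> i \<in> carrier (homology_group 1 X)" if "i \<in> I" for i
    by (rule dual_basis_H1_closed[OF basis that])
  have coeff: "dlog_pairing (f j) (?P c) = of_int (c j)" if "j \<in> I" for c j
  proof -
    have "dlog_pairing (f j) (?P c) = (\<Sum>i\<in>I. of_int (c i) * (if j = i then 1 else 0))"
      using that \<gamma>
      by (simp add: dlog_pairing_finprod[OF f] dlog_pairing_group_int_pow[OF f] \<open>finite I\<close>
          dual_basis_H1_pairing[OF basis])
    then show ?thesis
      using that \<open>finite I\<close> by (simp add: if_distrib cong: if_cong)
  qed
  have span: "\<exists>!c. c \<in> I \<rightarrow>\<^sub>E (UNIV :: int set) \<and> h = ?P c"
    if "h \<in> carrier (homology_group 1 X)" for h
    by (rule bspec[OF conjunct1[OF conjunct2[OF basis[unfolded dual_basis_H1_def]]] that])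
  obtain a where a: "a \<in> I \<rightarrow>\<^sub>E UNIV" "\<alpha> = ?P a"
    using ex1_implies_ex[OF span[OF \<alpha>]] by (elim exE conjE)
  obtain b where b: "b \<in> I \<rightarrow>\<^sub>E UNIV" "\<beta> = ?P b"
    using ex1_implies_ex[OF span[OF \<beta>]] by (elim exE conjE)
  have "a i = b i" if "i \<in> I" for i
    using eq[OF that] coeff[OF that, of a] coeff[OF that, of b] by (simp only: a(2) b(2) of_int_eq_iff)
  \<comment> \<open>The coefficient families are extensional, so agreement on \<open>I\<close> is
    equality.\<close>
  then have "a = b"
    by (rule PiE_ext[OF a(1) b(1)])
  then show ?thesis
    using a b by simp
qed

subsection \<open>Hypersurfaces defined by primitive characters\<close>

text \<open>Bezout's identity for finitely many integers. For a primitive exponent vector it yields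
  a one-parameter subgroup on which the character restricts to the identity.\<close>

lemma Gcd_image_bezout:
  fixes a :: "'i \<Rightarrow> int"
  assumes "finite I"
  shows "\<exists>c. (\<Sum>i\<in>I. a i * c i) = Gcd (a ` I)"
  using assms
proof (induction I rule: finite_induct)
  case (insert j I)
  then obtain c where c: "(\<Sum>i\<in>I. a i * c i) = Gcd (a ` I)"
    by blast
  obtain u v where uv: "u * a j + v * Gcd (a ` I) = gcd (a j) (Gcd (a ` I))"
    using bezout_int by blast
  \<comment> \<open>The earlier coefficients are rescaled by the two-term Bezout coefficient
    \<open>v\<close>, and \<open>j\<close> receives \<open>u\<close>.\<close>
  define c' where "c' i = (if i = j then u else v * c i)" for i
  have "(\<Sum>i\<in>I. a i * c' i) = (\<Sum>i\<in>I. v * (a i * c i))"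
    using insert.hyps by (intro sum.cong) (auto simp: c'_def)
  then have "(\<Sum>i\<in>insert j I. a i * c' i) = Gcd (a ` insert j I)"
    using insert.hyps uv c by (simp add: c'_def mult.commute flip: sum_distrib_left)
  then show ?case
    by blast
qed simp

lemma power_int_sum:
  fixes z :: "'a :: field"
  assumes "z \<noteq> 0"
  shows "z powi (\<Sum>i\<in>I. e i) = (\<Prod>i\<in>I. z powi e i)"
  using assms by (induction I rule: infinite_finite_induct) (auto simp: power_int_add)

text \<open>The polynomial is monic, and its derivative vanishes at most at 0, which is not a root
  since \<open>c \<noteq> 0\<close>. Hence all roots are simple and it is the product of its linear
  factors.\<close>

lemma prod_minus_nth_roots:
  fixes z c :: complex
  assumes "c \<noteq> 0" "N > 0"
  shows "(\<Prod>\<rho> | \<rho> ^ N = c. z - \<rho>) = z ^ N - c"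
proof -
  let ?p = "monom 1 N + [:- c:]"
  have p: "poly ?p w = w ^ N - c" for w
    by (simp add: poly_monom)
  have "degree ?p = N"
    using assms by (subst degree_add_eq_left) (auto simp: degree_monom_eq)
  then have "lead_coeff ?p = 1"
    using assms by (simp add: coeff_pCons split: nat.split)
  moreover have "rsquarefree ?p"
    unfolding rsquarefree_roots using assms
    by (auto simp: p pderiv_add pderiv_monom poly_monom pderiv_pCons)
  ultimately have "(\<Prod>w | poly ?p w = 0. [:- w, 1:]) = ?p"
    using complex_poly_decompose_rsquarefree[of ?p] by simp
  then have "poly (\<Prod>w | poly ?p w = 0. [:- w, 1:]) z = z ^ N - c"
    using p by simp
  then show ?thesis
    by (simp add: poly_prod poly_monom)
qed

section \<open>Characters and one-parameter subgroups of the torus\<close>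

lemma topspace_torus: "topspace (torus d) = (\<Pi>\<^sub>E k\<in>{1..d}. - {0})"
  by (simp add: torus_def)

lemma torus_nonzero: "x \<in> topspace (torus d) \<Longrightarrow> k \<in> {1..d} \<Longrightarrow> x k \<noteq> 0"
  unfolding topspace_torus by (drule (1) PiE_mem) simp

lemma monomial_nonzero:
  assumes "x \<in> topspace (torus d)"
  shows "monomial d e x \<noteq> 0"
  using torus_nonzero[OF assms] by (simp add: monomial_def)

lemma monomial_cong:
  assumes "\<And>k. k \<in> {1..d} \<Longrightarrow> e k = e' k"
  shows "monomial d e x = monomial d e' x"
  unfolding monomial_def by (rule prod.cong) (simp_all add: assms)

lemma monomial_add:
  assumes "x \<in> topspace (torus d)"
  shows "monomial d (\<lambda>k. e k + e' k) x = monomial d e x * monomial d e' x"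
  unfolding monomial_def prod.distrib[symmetric]
  by (intro prod.cong refl power_int_add disjI1 torus_nonzero[OF assms])

lemma monomial_minus: "monomial d (\<lambda>k. - e k) x = inverse (monomial d e x)"
  unfolding monomial_def by (simp add: power_int_minus flip: prod_inversef)

lemma monomial_times_const:
  assumes "N \<ge> 0"
  shows "monomial d (\<lambda>k. N * e k) x = monomial d e x ^ nat N"
proof -
  have "x k powi (e k * N) = (x k powi e k) ^ nat N" for k
    using power_int_mult[of "x k" "e k" "int (nat N)"] assms
    by (simp only: power_int_of_nat) (simp only: int_nat_eq if_True)
  then show ?thesis
    by (simp only: monomial_def prod_power_distrib mult.commute[of N])
qed

lemma monomial_exp:
  "monomial d e (\<lambda>k\<in>{1..d}. exp (u k)) = exp (\<Sum>k\<in>{1..d}. of_int (e k) * u k)"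
  by (simp add: monomial_def exp_sum exp_power_int)

text \<open>The vector \<open>w\<close> is a cocharacter, moving points of the torus along a
  one-parameter subgroup with parameter \<open>t\<close>; the exponent of \<open>t\<close> on the
  right is the usual pairing of a character with a cocharacter.\<close>

lemma monomial_mult_cocharacter:
  assumes "t \<noteq> 0"
  shows "monomial d e (\<lambda>k\<in>{1..d}. x k * t powi w k)
    = monomial d e x * t powi (\<Sum>k\<in>{1..d}. e k * w k)"
proof -
  have "monomial d e (\<lambda>k\<in>{1..d}. x k * t powi w k)
      = (\<Prod>k\<in>{1..d}. x k powi e k * t powi (e k * w k))"
    unfolding monomial_def
    by (rule prod.cong) (auto simp: power_int_mult_distrib power_int_mult[symmetric] mult.commute)
  then show ?thesis
    using assms by (simp add: monomial_def power_int_sum prod.distrib)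
qed

lemma nonvanishing_map_torus_coordinate:
  "k \<in> {1..d} \<Longrightarrow> nonvanishing_map (torus d) (\<lambda>x. x k)"
  unfolding torus_def by (rule continuous_map_product_projection)

lemma nonvanishing_map_monomial: "nonvanishing_map (torus d) (monomial d e)"
  unfolding monomial_def[abs_def]
  by (intro nonvanishing_map_prod nonvanishing_map_power_int nonvanishing_map_torus_coordinate)

text \<open>For primitive \<open>a\<close> and nonzero \<open>\<rho>\<close> this is a translate of
  the connected subtorus on which the character \<open>a\<close> is trivial; the members of
  \<open>\<B>\<close> have this shape.\<close>

definition level_set :: "nat \<Rightarrow> (nat \<Rightarrow> int) \<Rightarrow> complex \<Rightarrow> (nat \<Rightarrow> complex) set"
  where "level_set d a \<rho> = {x \<in> topspace (torus d). monomial d a x = \<rho>}"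

lemma level_set_nonempty:
  assumes "Gcd (a ` {1..d}) = 1" "\<rho> \<noteq> 0"
  shows "level_set d a \<rho> \<noteq> {}"
proof -
  obtain c where c: "(\<Sum>k\<in>{1..d}. a k * c k) = 1"
    using Gcd_image_bezout[of "{1..d}" a] assms by auto
  \<comment> \<open>The witness is the identity of the torus moved along the cocharacter
    \<open>c\<close> with parameter \<open>\<rho>\<close>; the pairing of \<open>a\<close> and
    \<open>c\<close> is 1. The factor \<open>1 *\<close> displays the identity point.\<close>
  have "monomial d a (\<lambda>k\<in>{1..d}. 1 * \<rho> powi c k) = \<rho>"
    unfolding monomial_mult_cocharacter[OF \<open>\<rho> \<noteq> 0\<close>] c by (simp add: monomial_def)
  then have "(\<lambda>k\<in>{1..d}. 1 * \<rho> powi c k) \<in> level_set d a \<rho>"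
    using assms by (auto simp: level_set_def topspace_torus)
  then show ?thesis
    by blast
qed

text \<open>
  The exponential map carries the affine subspace \<open>\<Sum>k. a k * u k = Ln \<rho>\<close> onto the level set:
  by Bezout's identity the multivaluedness of the logarithm can be absorbed into \<open>u\<close>.
\<close>

lemma level_set_logarithm:
  assumes "Gcd (a ` {1..d}) = 1" "x \<in> level_set d a \<rho>"
  obtains u where "x = (\<lambda>k\<in>{1..d}. exp (u k))"
    "(\<Sum>k\<in>{1..d}. of_int (a k) * u k) = Ln \<rho>"
proof -
  have x: "x \<in> topspace (torus d)" "monomial d a x = \<rho>"
    using assms by (auto simp: level_set_def)
  have x_eq: "x = (\<lambda>k\<in>{1..d}. exp (Ln (x k)))"
    by (rule PiE_ext[OF x(1)[unfolded topspace_torus]]) (use torus_nonzero[OF x(1)] in auto)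
  have "\<rho> \<noteq> 0"
    using x monomial_nonzero by blast
  have "exp (\<Sum>k\<in>{1..d}. of_int (a k) * Ln (x k)) = exp (Ln \<rho>)"
    using x(2) monomial_exp[of d a "\<lambda>k. Ln (x k)"] x_eq \<open>\<rho> \<noteq> 0\<close> by simp
  then obtain n :: int where
    n: "(\<Sum>k\<in>{1..d}. of_int (a k) * Ln (x k)) = Ln \<rho> + (of_int (2 * n) * pi) * \<i>"
    unfolding exp_eq by blast
  obtain c where c: "(\<Sum>k\<in>{1..d}. a k * c k) = 1"
    using Gcd_image_bezout[of "{1..d}" a] assms by auto
  \<comment> \<open>Subtracting \<open>2 * pi * \<i> * n * c k\<close> leaves every exponential
    unchanged and lowers the weighted sum by exactly the surplus \<open>2 * pi * \<i> * n\<close>,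
    because \<open>a\<close> and \<open>c\<close> pair to 1.\<close>
  define u where "u k = Ln (x k) - of_int (2 * (n * c k)) * pi * \<i>" for k
  have "exp (u k) = exp (Ln (x k))" for k
    unfolding exp_eq u_def by (rule exI[of _ "- n * c k"]) simp
  then have "x = (\<lambda>k\<in>{1..d}. exp (u k))"
    using x_eq by simp
  moreover have "(\<Sum>k\<in>{1..d}. of_int (a k) * u k) = Ln \<rho>"
  proof -
    have "(\<Sum>k\<in>{1..d}. of_int (a k) * u k) = (\<Sum>k\<in>{1..d}. of_int (a k) * Ln (x k))
        - (\<Sum>k\<in>{1..d}. of_int (2 * n) * pi * \<i> * of_int (a k * c k))"
      unfolding sum_subtractf[symmetric] by (rule sum.cong) (auto simp: u_def algebra_simps)
    also have "\<dots> = (\<Sum>k\<in>{1..d}. of_int (a k) * Ln (x k))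
        - of_int (2 * n) * pi * \<i> * of_int (\<Sum>k\<in>{1..d}. a k * c k)"
      by (simp add: sum_distrib_left)
    also have "of_int (\<Sum>k\<in>{1..d}. a k * c k) = (1 :: complex)"
      using c by simp
    finally show ?thesis
      using n by simp
  qed
  ultimately show thesis
    by (rule that)
qed

text \<open>Logarithms of two points can be chosen in one affine subspace. The segment between them
  stays there, and its exponential is a path inside the level set.\<close>

lemma connectedin_level_set:
  assumes "Gcd (a ` {1..d}) = 1"
  shows "connectedin (torus d) (level_set d a \<rho>)"
proof (rule path_connectedin_imp_connectedin)
  show "path_connectedin (torus d) (level_set d a \<rho>)"
    unfolding path_connectedin
  proof (intro conjI ballI)
    fix x y assume x: "x \<in> level_set d a \<rho>" and y: "y \<in> level_set d a \<rho>"
    obtain u where u: "x = (\<lambda>k\<in>{1..d}. exp (u k))"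
        "(\<Sum>k\<in>{1..d}. of_int (a k) * u k) = Ln \<rho>"
      using level_set_logarithm[OF assms x] by metis
    obtain v where v: "y = (\<lambda>k\<in>{1..d}. exp (v k))"
        "(\<Sum>k\<in>{1..d}. of_int (a k) * v k) = Ln \<rho>"
      using level_set_logarithm[OF assms y] by metis
    have "\<rho> \<noteq> 0"
      using x monomial_nonzero by (auto simp: level_set_def)
    define g where "g s = (\<lambda>k\<in>{1..d}. exp ((1 - of_real s) * u k + of_real s * v k))"
      for s :: real
    have "continuous_map (top_of_set {0..1}) (top_of_set (- {0})) (\<lambda>s. g s k)"
      if "k \<in> {1..d}" for k
      using that
      by (auto simp: g_def continuous_map_in_subtopology intro!: continuous_intros)
    then have "pathin (torus d) g"
      unfolding pathin_def torus_def continuous_map_componentwise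
      by (auto simp: g_def)
    moreover have "g s \<in> level_set d a \<rho>" for s
    proof -
      have "(\<Sum>k\<in>{1..d}. of_int (a k) * ((1 - of_real s) * u k + of_real s * v k))
          = (1 - of_real s) * (\<Sum>k\<in>{1..d}. of_int (a k) * u k)
            + of_real s * (\<Sum>k\<in>{1..d}. of_int (a k) * v k)"
        by (simp add: sum_distrib_left sum.distrib distrib_left mult.left_commute)
      also have "\<dots> = Ln \<rho>"
        by (simp only: u v) (simp add: algebra_simps)
      finally show ?thesis
        using \<open>\<rho> \<noteq> 0\<close>
        by (auto simp: g_def level_set_def monomial_exp topspace_torus)
    qed
    moreover have "g 0 = x" "g 1 = y"
      by (auto simp: g_def u v)
    ultimately show "\<exists>g. pathin (torus d) g \<and> g \<in> {0..1} \<rightarrow> level_set d a \<rho> \<and> g 0 = x \<and> g 1 = y"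
      by (intro exI[of _ g]) auto
  qed (auto simp: level_set_def)
qed

text \<open>
  Translation by the one-parameter subgroups in the kernel of \<open>a\<close> preserves the first level set,
  hence its value under \<open>b\<close>; so \<open>b\<close> is an integer multiple of \<open>a\<close>.
\<close>

lemma level_set_subset_imp:
  assumes a: "Gcd (a ` {1..d}) = 1" and b: "Gcd (b ` {1..d}) = 1"
    and "\<rho> \<noteq> 0" and sub: "level_set d a \<rho> \<subseteq> level_set d b \<kappa>"
  shows "(\<forall>k\<in>{1..d}. b k = a k) \<and> \<kappa> = \<rho> \<or> (\<forall>k\<in>{1..d}. b k = - a k) \<and> \<kappa> = inverse \<rho>"
proof -
  obtain x where x: "x \<in> level_set d a \<rho>"
    using level_set_nonempty[OF a \<open>\<rho> \<noteq> 0\<close>] by blast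
  then have xT: "x \<in> topspace (torus d)" and xa: "monomial d a x = \<rho>"
    and xb: "monomial d b x = \<kappa>"
    using sub by (auto simp: level_set_def)
  have orth: "(\<Sum>k\<in>{1..d}. b k * w k) = 0" if w: "(\<Sum>k\<in>{1..d}. a k * w k) = 0" for w
  proof -
    \<comment> \<open>The parameter 2 is chosen because it is not a root of unity:
      \<open>2 powi e = 1\<close> forces \<open>e = 0\<close>.\<close>
    let ?y = "\<lambda>k\<in>{1..d}. x k * 2 powi w k"
    have "?y \<in> level_set d a \<rho>"
      using torus_nonzero[OF xT]
      by (auto simp: level_set_def topspace_torus monomial_mult_cocharacter w xa)
    then have "monomial d b ?y = \<kappa>"
      using sub by (auto simp: level_set_def)
    then have "\<kappa> * 2 powi (\<Sum>k\<in>{1..d}. b k * w k) = \<kappa>"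
      using monomial_mult_cocharacter[of 2 d b x w] xb by simp
    moreover have "\<kappa> \<noteq> 0"
      using xT xb monomial_nonzero by blast
    ultimately have "(2 :: complex) powi (\<Sum>k\<in>{1..d}. b k * w k) = 1"
      by simp
    then have "norm ((2 :: complex) powi (\<Sum>k\<in>{1..d}. b k * w k)) = 1"
      by simp
    then have "(2 :: real) powi (\<Sum>k\<in>{1..d}. b k * w k) = 1"
      by (simp add: norm_power_int)
    then show ?thesis
      using power_int_strict_increasing[of 0 "\<Sum>k\<in>{1..d}. b k * w k" "2 :: real"]
        power_int_strict_increasing[of "\<Sum>k\<in>{1..d}. b k * w k" 0 "2 :: real"]
      by (cases "(\<Sum>k\<in>{1..d}. b k * w k)" "0 :: int" rule: linorder_cases) auto
  qed
  obtain c where c: "(\<Sum>k\<in>{1..d}. a k * c k) = 1"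
    using Gcd_image_bezout[of "{1..d}" a] a by auto
  define q where "q = (\<Sum>k\<in>{1..d}. b k * c k)"
  \<comment> \<open>The k-th unit vector minus \<open>a k\<close> times \<open>c\<close> pairs to 0
    with \<open>a\<close>, hence also with \<open>b\<close>; expanding the latter gives the
    claim.\<close>
  have bq: "b k = a k * q" if "k \<in> {1..d}" for k
  proof -
    have *: "(\<Sum>j\<in>{1..d}. e j * ((if j = k then 1 else 0) - a k * c j))
        = e k - a k * (\<Sum>j\<in>{1..d}. e j * c j)" for e :: "nat \<Rightarrow> int"
    proof -
      have "(\<Sum>j\<in>{1..d}. e j * (if j = k then 1 else 0)) = e k"
        using that by (simp add: if_distrib cong: if_cong)
      then show ?thesis
        by (simp only: right_diff_distrib sum_subtractf sum_distrib_left mult.left_commute)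
    qed
    show ?thesis
      using orth[of "\<lambda>j. (if j = k then 1 else 0) - a k * c j"] by (simp add: * c q_def)
  qed
  \<comment> \<open>Primitivity of \<open>b\<close> leaves only the units 1 and -1 for
    \<open>q\<close>, which are the two alternatives of the conclusion.\<close>
  then have "q dvd Gcd (b ` {1..d})"
    by (auto intro!: Gcd_greatest)
  then have "q = 1 \<or> q = - 1"
    using b by auto
  then show ?thesis
  proof
    assume "q = 1"
    then have "b k = a k" if "k \<in> {1..d}" for k
      using bq that by simp
    then show ?thesis
      using xa xb monomial_cong[of d b a x] by auto
  next
    assume "q = - 1"
    then have "b k = - a k" if "k \<in> {1..d}" for k
      using bq that by simp
    then show ?thesis
      using xa xb monomial_cong[of d b "\<lambda>k. - a k" x] by (auto simp: monomial_minus)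
  qed
qed

text \<open>A component has connected image in a finite subset of the plane, hence a single point,
  so it lies in one fibre. Conversely that fibre is connected and meets the component, so maximality
  puts it inside.\<close>

lemma connected_components_of_fibres:
  fixes h :: "'a \<Rightarrow> complex"
  assumes h: "continuous_map X euclidean h" "h \<in> topspace X \<rightarrow> F" and "finite F"
    and conn: "\<And>\<rho>. \<rho> \<in> F \<Longrightarrow> connectedin X {x \<in> topspace X. h x = \<rho>}"
    and ne: "\<And>\<rho>. \<rho> \<in> F \<Longrightarrow> {x \<in> topspace X. h x = \<rho>} \<noteq> {}"
  shows "connected_components_of X = (\<lambda>\<rho>. {x \<in> topspace X. h x = \<rho>}) ` F"
proof -
  have fibre: "C = {y \<in> topspace X. h y = h x}" if C: "C \<in> connected_components_of X" "x \<in> C" for C x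
  proof
    have CX: "C \<subseteq> topspace X"
      using C connected_components_of_subset by blast
    have "connected (h ` C)"
      using connectedin_continuous_map_image[OF h(1) connectedin_connected_components_of[OF C(1)]]
      by simp
    moreover have "finite (h ` C)"
      using CX h(2) \<open>finite F\<close> by (blast intro: finite_subset)
    ultimately obtain z where "h ` C = {z}"
      using connected_finite_iff_sing[of "h ` C"] C(2) by auto
    then have "h y = h x" if "y \<in> C" for y
      using that C(2) by (metis imageI singletonD)
    then show "C \<subseteq> {y \<in> topspace X. h y = h x}"
      using CX by blast
    show "{y \<in> topspace X. h y = h x} \<subseteq> C"
    proof (rule connected_components_of_maximal[OF C(1) conn])
      show "h x \<in> F"
        using h(2) CX C(2) by blast
      show "\<not> disjnt C {y \<in> topspace X. h y = h x}"
        using C(2) CX by (auto simp: disjnt_iff)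
    qed
  qed
  show ?thesis
  proof (intro equalityI subsetI)
    fix C assume C: "C \<in> connected_components_of X"
    then obtain x where x: "x \<in> C" "x \<in> topspace X"
      using nonempty_connected_components_of connected_components_of_subset by blast
    have "h x \<in> F"
      using h(2) x(2) by (rule Pi_mem)
    then show "C \<in> (\<lambda>\<rho>. {x \<in> topspace X. h x = \<rho>}) ` F"
      by (intro image_eqI[where x = "h x"] fibre[OF C x(1)])
  next
    fix C assume "C \<in> (\<lambda>\<rho>. {x \<in> topspace X. h x = \<rho>}) ` F"
    then obtain \<rho> where \<rho>: "\<rho> \<in> F" "C = {x \<in> topspace X. h x = \<rho>}"
      by (elim imageE)
    then obtain x where x: "x \<in> topspace X" "h x = \<rho>"
      using ne[OF \<rho>(1)] by auto
    then obtain C' where C': "C' \<in> connected_components_of X" "x \<in> C'"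
      using Union_connected_components_of[of X] by blast
    have "C' = C"
      unfolding fibre[OF C'] \<rho>(2) x(2) ..
    then show "C \<in> connected_components_of X"
      using C'(1) by simp
  qed
qed

text \<open>The locus is the preimage under \<open>x^a\<close> of the finitely many
  \<open>N\<close>-th roots of \<open>c\<close>; as \<open>a\<close> is primitive, the fibres over
  these nonzero values are connected and nonempty.\<close>

lemma connected_components_of_power_level_set:
  assumes a: "Gcd (a ` {1..d}) = 1" and "c \<noteq> 0" "N > 0"
  shows "components_in (torus d) {x \<in> topspace (torus d). monomial d a x ^ N = c}
    = level_set d a ` {\<rho>. \<rho> ^ N = c}"
proof -
  let ?E = "{x \<in> topspace (torus d). monomial d a x ^ N = c}"
  let ?X = "subtopology (torus d) ?E"
  have fib: "{x \<in> topspace ?X. monomial d a x = \<rho>} = level_set d a \<rho>" if "\<rho> ^ N = c" for \<rho>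
    using that by (auto simp: level_set_def)
  have nz: "\<rho> \<noteq> 0" if "\<rho> ^ N = c" for \<rho>
    using that assms by auto
  have "connected_components_of ?X = (\<lambda>\<rho>. {x \<in> topspace ?X. monomial d a x = \<rho>}) ` {\<rho>. \<rho> ^ N = c}"
  proof (rule connected_components_of_fibres)
    show "continuous_map ?X euclidean (monomial d a)"
      using nonvanishing_map_monomial
      by (auto simp: nonvanishing_map_iff intro: continuous_map_from_subtopology)
    show "finite {\<rho>. \<rho> ^ N = c}"
      using card_nth_roots[OF assms(2,3)] assms(3) card.infinite by fastforce
    show "connectedin ?X {x \<in> topspace ?X. monomial d a x = \<rho>}" if "\<rho> \<in> {\<rho>. \<rho> ^ N = c}" for \<rho>
    proof -
      have "level_set d a \<rho> \<subseteq> ?E"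
        using that by (auto simp: level_set_def)
      then have "connectedin ?X (level_set d a \<rho>)"
        using connectedin_level_set[OF a] by (simp add: connectedin_subtopology)
      then show ?thesis
        using that by (simp only: fib mem_Collect_eq)
    qed
    show "{x \<in> topspace ?X. monomial d a x = \<rho>} \<noteq> {}" if "\<rho> \<in> {\<rho>. \<rho> ^ N = c}" for \<rho>
      using that level_set_nonempty[OF a nz] by (simp only: fib mem_Collect_eq) simp
  qed auto
  also have "\<dots> = level_set d a ` {\<rho>. \<rho> ^ N = c}"
    using fib by (intro image_cong refl) simp
  finally show ?thesis .
qed

text \<open>Allows sums and cardinalities over components to be reindexed by the corresponding
  roots.\<close>

lemma inj_on_level_set:
  assumes "Gcd (a ` {1..d}) = 1"
  shows "inj_on (level_set d a) (- {0})"
proof (rule inj_onI)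
  fix \<rho> \<kappa> :: complex
  assume "\<rho> \<in> - {0}" and eq: "level_set d a \<rho> = level_set d a \<kappa>"
  then have "level_set d a \<rho> \<noteq> {}"
    by (intro level_set_nonempty[OF assms]) simp
  then obtain x where "x \<in> level_set d a \<rho>"
    by blast
  moreover from this have "x \<in> level_set d a \<kappa>"
    by (simp only: eq)
  ultimately show "\<rho> = \<kappa>"
    by (simp add: level_set_def)
qed

subsection \<open>Complements of toric arrangements\<close>

lemma nonvanishing_map_complement:
  "nonvanishing_map (torus d) f \<Longrightarrow> nonvanishing_map (complement_space d \<B>) f"
  unfolding complement_space_def by (rule continuous_map_from_subtopology)

lemma dlog_pairing_monomial:
  assumes "\<gamma> \<in> carrier (homology_group 1 (complement_space d \<B>))"
  shows "dlog_pairing (monomial d e) \<gamma> = (\<Sum>k\<in>{1..d}. of_int (e k) * dlog_pairing (\<lambda>x. x k) \<gamma>)"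
proof -
  have coord: "nonvanishing_map (complement_space d \<B>) (\<lambda>x. x k)" if "k \<in> {1..d}" for k
    by (intro nonvanishing_map_complement nonvanishing_map_torus_coordinate that)
  have "dlog_pairing (monomial d e) \<gamma> = (\<Sum>k\<in>{1..d}. dlog_pairing (\<lambda>x. x k powi e k) \<gamma>)"
    unfolding monomial_def[abs_def]
    by (rule dlog_pairing_prod[OF nonvanishing_map_power_int[OF coord] assms])
  also have "\<dots> = (\<Sum>k\<in>{1..d}. of_int (e k) * dlog_pairing (\<lambda>x. x k) \<gamma>)"
    by (intro sum.cong refl dlog_pairing_power_int[OF coord assms])
  finally show ?thesis .
qed

text \<open>Pulling the common divisor out of the family multiplies its gcd by that divisor, which
  then cancels. This is the primitivity of \<open>prim_dir\<close>.\<close>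

lemma Gcd_image_div_Gcd:
  fixes e :: "'i \<Rightarrow> int"
  assumes "Gcd (e ` I) \<noteq> 0"
  shows "Gcd ((\<lambda>i. e i div Gcd (e ` I)) ` I) = 1"
proof -
  let ?g = "Gcd (e ` I)"
  have "(*) ?g ` (\<lambda>i. e i div ?g) ` I = e ` I"
    unfolding image_image by (intro image_cong refl) simp
  then have "normalize (?g * Gcd ((\<lambda>i. e i div ?g) ` I)) = ?g"
    by (simp only: Gcd_mult[symmetric])
  then have "?g * Gcd ((\<lambda>i. e i div ?g) ` I) = ?g * 1"
    by (simp only: normalize_mult normalize_Gcd mult_1_right)
  then show ?thesis
    using assms by (simp only: mult_cancel_left) simp
qed


subsection \<open>The root map of a corank-one TM-ideal\<close>

lemma proj_extend:
  assumes "x \<in> topspace (torus d)"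
  shows "proj d (x(Suc d := y)) = x"
proof -
  have "restrict (x(Suc d := y)) {1..d} = restrict x {1..d}"
    by (rule restrict_ext) auto
  then show ?thesis
    using PiE_restrict[OF assms[unfolded topspace_torus]] by (simp add: proj_def)
qed

lemma monomial_extend: "monomial d e (x(Suc d := y)) = monomial d e x"
  unfolding monomial_def by (rule prod.cong) auto

lemma monomial_proj: "monomial d e (proj d t) = monomial d e t"
  unfolding monomial_def proj_def by (rule prod.cong) auto

lemma extend_in_torus:
  assumes "x \<in> topspace (torus d)" "y \<noteq> 0"
  shows "x(Suc d := y) \<in> topspace (torus (Suc d))"
  unfolding topspace_torus
proof (rule PiE_I)
  show "(x(Suc d := y)) k \<in> - {0}" if "k \<in> {1..Suc d}" for k
  proof (cases "k = Suc d")
    case True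
    then show ?thesis
      using assms(2) by simp
  next
    case False
    then have "k \<in> {1..d}"
      using that by simp
    then show ?thesis
      using torus_nonzero[OF assms(1)] False by simp
  qed
  show "(x(Suc d := y)) k = undefined" if "k \<notin> {1..Suc d}" for k
  proof -
    have "k \<notin> {1..d}" "k \<noteq> Suc d"
      using that by auto
    then show ?thesis
      using PiE_arb[OF assms(1)[unfolded topspace_torus], of k] by simp
  qed
qed

lemma proj_in_torus:
  assumes "t \<in> topspace (torus (Suc d))"
  shows "proj d t \<in> topspace (torus d)"
proof -
  have "t k \<in> - {0}" if "k \<in> {1..d}" for k
    using torus_nonzero[OF assms, of k] that by simp
  then show ?thesis
    unfolding topspace_torus proj_def restrict_PiE_iff by blast
qed

text \<open>The equations of \<open>\<B>\<close> enter as \<open>level_set\<close> so that level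
  sets can be compared directly; \<open>mH\<close> may carry either sign on each
  hypersurface.\<close>

locale corank_one_arrangement =
  fixes d l :: nat
    and \<A> \<B> :: "(nat \<Rightarrow> complex) set set"
    and Hs :: "nat \<Rightarrow> (nat \<Rightarrow> complex) set"
    and m :: "nat \<Rightarrow> nat \<Rightarrow> int"
    and \<mu> :: "nat \<Rightarrow> complex"
    and mH :: "(nat \<Rightarrow> complex) set \<Rightarrow> nat \<Rightarrow> int"
    and \<mu>H :: "(nat \<Rightarrow> complex) set \<Rightarrow> complex"
  assumes TM_ideal: "corank_one_TM_ideal (Suc d) (last_coord_subgroup d) \<A>"
    and enumeration:
      "bij_betw Hs {1..l} (\<A> - sub_arrangement (Suc d) (last_coord_subgroup d) \<A>)"
    and B: "\<B> = quotient_arrangement d \<A>"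
    and root_of_unity: "\<And>j. j \<in> {1..l} \<Longrightarrow> root_of_unity (\<mu> j)"
    and Hs_eq: "\<And>j. j \<in> {1..l} \<Longrightarrow>
      Hs j = {t \<in> topspace (torus (Suc d)). t (Suc d) = \<mu> j * monomial d (m j) t}"
    and B_primitive: "\<And>H. H \<in> \<B> \<Longrightarrow> Gcd (mH H ` {1..d}) = 1"
    and B_eq: "\<And>H. H \<in> \<B> \<Longrightarrow> H = level_set d (mH H) (\<mu>H H)"
begin

abbreviation M where "M \<equiv> complement_space d \<B>"

abbreviation defining_map :: "(nat \<Rightarrow> complex) set \<Rightarrow> (nat \<Rightarrow> complex) \<Rightarrow> complex"
  where "defining_map H x \<equiv> monomial d (mH H) x - \<mu>H H"

section \<open>Graphs over the base torus, and the root map off \<open>\<B>\<close>\<close>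

lemma mu_nonzero:
  assumes "j \<in> {1..l}"
  shows "\<mu> j \<noteq> 0"
proof
  assume "\<mu> j = 0"
  moreover obtain q where "q > 0" "\<mu> j ^ q = 1"
    using root_of_unity[OF assms] unfolding root_of_unity_def by blast
  ultimately show False
    by (simp add: power_0_left)
qed

text \<open>Each \<open>Hs i\<close> is the graph of a function of the first \<open>d\<close>
  coordinates, so two of them meet exactly over the points where these functions agree.\<close>

lemma proj_intersection:
  assumes "i \<in> {1..l}" "j \<in> {1..l}"
  shows "proj d ` (Hs i \<inter> Hs j)
    = {x \<in> topspace (torus d). \<mu> j * monomial d (m j) x = \<mu> i * monomial d (m i) x}"
proof (intro equalityI subsetI)
  fix x assume "x \<in> proj d ` (Hs i \<inter> Hs j)"
  then obtain t where t: "x = proj d t" "t \<in> Hs i" "t \<in> Hs j"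
    by blast
  have "t \<in> topspace (torus (Suc d))" "t (Suc d) = \<mu> i * monomial d (m i) t"
      "t (Suc d) = \<mu> j * monomial d (m j) t"
    using t(2,3) unfolding Hs_eq[OF assms(1)] Hs_eq[OF assms(2)] by blast+
  then show "x \<in> {x \<in> topspace (torus d). \<mu> j * monomial d (m j) x = \<mu> i * monomial d (m i) x}"
    using proj_in_torus[of t d] by (simp add: t(1) monomial_proj)
next
  fix x assume x: "x \<in> {x \<in> topspace (torus d). \<mu> j * monomial d (m j) x = \<mu> i * monomial d (m i) x}"
  let ?t = "x(Suc d := \<mu> i * monomial d (m i) x)"
  have xT: "x \<in> topspace (torus d)"
    using x by simp
  have "?t \<in> topspace (torus (Suc d))"
    using monomial_nonzero[OF xT] mu_nonzero[OF assms(1)] by (intro extend_in_torus xT) simp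
  then have "?t \<in> Hs i" "?t \<in> Hs j"
    using x unfolding Hs_eq[OF assms(1)] Hs_eq[OF assms(2)] by (simp_all add: monomial_extend)
  then show "x \<in> proj d ` (Hs i \<inter> Hs j)"
    using proj_extend[OF xT] by (intro image_eqI[where x = ?t]) auto
qed

lemma Hs_distinct:
  assumes "i \<in> {1..l}" "j \<in> {1..l}" "i \<noteq> j"
  shows "Hs i \<noteq> Hs j"
  using inj_on_eq_iff[OF bij_betw_imp_inj_on[OF enumeration] assms(1,2)] assms(3) by simp

text \<open>
  A connected subset of \<open>\<pi>(H\<^sub>i \<inter> H\<^sub>j)\<close> lifts to the graph of the function defining \<open>H\<^sub>i\<close>, where the
  TM-ideal condition applies.
\<close>

lemma connected_subset_intersection_in_B:
  assumes ij: "i \<in> {1..l}" "j \<in> {1..l}" "i \<noteq> j"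
    and S: "connectedin (torus d) S" "S \<subseteq> proj d ` (Hs i \<inter> Hs j)" "S \<noteq> {}"
  obtains H where "H \<in> \<B>" "S \<subseteq> H"
proof -
  let ?g = "\<lambda>x. x(Suc d := \<mu> i * monomial d (m i) x)"
  let ?X = "subtopology (torus (Suc d)) (Hs i \<inter> Hs j)"
  have ST: "x \<in> topspace (torus d)" "\<mu> j * monomial d (m j) x = \<mu> i * monomial d (m i) x"
    if "x \<in> S" for x
    using S(2) that unfolding proj_intersection[OF ij(1,2)] by blast+
  have gT: "?g x \<in> topspace (torus (Suc d))" if "x \<in> topspace (torus d)" for x
    using monomial_nonzero[OF that] mu_nonzero[OF ij(1)] by (intro extend_in_torus that) simp
  have "continuous_map (torus d) (torus (Suc d)) ?g"
    unfolding torus_def[of "Suc d"] continuous_map_componentwise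
  proof (intro conjI ballI)
    show "?g ` topspace (torus d) \<subseteq> extensional {1..Suc d}"
      using gT by (auto simp: topspace_torus[of "Suc d"] PiE_def)
    show "nonvanishing_map (torus d) (\<lambda>x. ?g x k)" if "k \<in> {1..Suc d}" for k
    proof (cases "k = Suc d")
      case True
      then show ?thesis
        using mu_nonzero[OF ij(1)]
        by (simp add: nonvanishing_map_mult nonvanishing_map_const nonvanishing_map_monomial)
    next
      case False
      then show ?thesis
        using that nonvanishing_map_torus_coordinate[of k d] by (simp add: le_Suc_eq)
    qed
  qed
  then have "connectedin (torus (Suc d)) (?g ` S)"
    using S(1) by (rule connectedin_continuous_map_image)
  moreover have gS: "?g ` S \<subseteq> Hs i \<inter> Hs j"
    using ST gT unfolding Hs_eq[OF ij(1)] Hs_eq[OF ij(2)] by (auto simp: monomial_extend)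
  ultimately have "connectedin ?X (?g ` S)"
    by (simp add: connectedin_subtopology)
  \<comment> \<open>A component containing the lifted set can only be found in a nonempty space;
    nonemptiness of \<open>S\<close> is used here.\<close>
  moreover have "?X \<noteq> trivial_topology"
  proof -
    obtain x where "x \<in> S"
      using S(3) by blast
    then have "?g x \<in> topspace ?X"
      using gS gT[OF ST(1)] by auto
    then show ?thesis
      by (metis empty_iff topspace_discrete_topology)
  qed
  ultimately obtain C where C: "C \<in> connected_components_of ?X" "?g ` S \<subseteq> C"
    using exists_connected_component_of_superset by blast
  have "Hs i \<in> \<A> - sub_arrangement (Suc d) (last_coord_subgroup d) \<A>"
      "Hs j \<in> \<A> - sub_arrangement (Suc d) (last_coord_subgroup d) \<A>"
    using enumeration ij by (auto simp: bij_betw_def)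
  \<comment> \<open>The TM-ideal condition speaks of whole components of the intersection, which is
    why the lifted set was first enlarged to \<open>C\<close>.\<close>
  then obtain H3 where H3: "H3 \<in> sub_arrangement (Suc d) (last_coord_subgroup d) \<A>" "C \<subseteq> H3"
    using TM_ideal[unfolded corank_one_TM_ideal_def] Hs_distinct[OF ij] C(1) by blast
  show thesis
  proof (rule that)
    show "proj d ` H3 \<in> \<B>"
      using H3(1) by (simp add: B quotient_arrangement_def)
    show "S \<subseteq> proj d ` H3"
    proof
      fix x assume "x \<in> S"
      then have "?g x \<in> H3"
        using C(2) H3(2) by blast
      then show "x \<in> proj d ` H3"
        using proj_extend[OF ST(1)[OF \<open>x \<in> S\<close>]] by (metis imageI)
    qed
  qed
qed

lemma topspace_M: "topspace M = topspace (torus d) - \<Union>\<B>"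
  by (auto simp: complement_space_def)

text \<open>A coincidence of roots puts \<open>x\<close> in the projected intersection, and the
  covering result applied to the connected set \<open>{x}\<close> places it in a member of
  \<open>\<B>\<close>.\<close>

lemma roots_distinct:
  assumes "x \<in> topspace M" "i \<in> {1..l}" "j \<in> {1..l}" "i \<noteq> j"
  shows "\<mu> j * monomial d (m j) x \<noteq> \<mu> i * monomial d (m i) x"
proof
  assume "\<mu> j * monomial d (m j) x = \<mu> i * monomial d (m i) x"
  then have "{x} \<subseteq> proj d ` (Hs i \<inter> Hs j)"
    using assms(1) unfolding proj_intersection[OF assms(2,3)] topspace_M by blast
  moreover have "connectedin (torus d) {x}"
    using assms(1) by (simp add: topspace_M)
  ultimately obtain H where "H \<in> \<B>" "{x} \<subseteq> H"
    using connected_subset_intersection_in_B[OF assms(2-4), of "{x}"] by blast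
  then show False
    using assms(1) by (auto simp: topspace_M)
qed

lemma nonvanishing_map_root:
  assumes "j \<in> {1..l}"
  shows "nonvanishing_map M (\<lambda>x. \<mu> j * monomial d (m j) x)"
  using mu_nonzero[OF assms]
  by (intro nonvanishing_map_mult nonvanishing_map_const nonvanishing_map_complement
      nonvanishing_map_monomial)

lemma nonvanishing_defining_map:
  assumes "H \<in> \<B>"
  shows "nonvanishing_map M (defining_map H)"
proof -
  have "nonvanishing_map M (monomial d (mH H))"
    by (intro nonvanishing_map_complement nonvanishing_map_monomial)
  moreover have "defining_map H x \<noteq> 0" if "x \<in> topspace M" for x
  proof
    assume "defining_map H x = 0"
    then have "x \<in> level_set d (mH H) (\<mu>H H)"
      using that by (auto simp: topspace_M level_set_def)
    then have "x \<in> H"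
      by (subst B_eq[OF assms])
    then show False
      using that assms by (auto simp: topspace_M)
  qed
  ultimately show ?thesis
    unfolding nonvanishing_map_iff by (auto simp: continuous_map_atin intro!: tendsto_diff)
qed

text \<open>Coordinate 1 is the constant 0 and coordinate \<open>j + 1\<close> is the j-th root.
  Injectivity therefore means that the roots are nonzero and pairwise distinct on
  \<open>M\<close>.\<close>

lemma continuous_map_root_map: "continuous_map M (Conf (Suc l)) (root_map d l \<mu> m)"
proof -
  have "continuous_map M (product_topology (\<lambda>_. euclidean) {1..Suc l}) (root_map d l \<mu> m)"
    unfolding continuous_map_componentwise
  proof (intro conjI ballI)
    show "root_map d l \<mu> m ` topspace M \<subseteq> extensional {1..Suc l}"
      by (auto simp: root_map_def)
    show "continuous_map M euclidean (\<lambda>x. root_map d l \<mu> m x r)" if "r \<in> {1..Suc l}" for r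
    proof (cases "r = 1")
      case True
      then show ?thesis
        by (simp add: root_map_def)
    next
      case False
      then have "r - 1 \<in> {1..l}"
        using that by auto
      then show ?thesis
        using nonvanishing_map_root[of "r - 1"] that False
        by (simp add: root_map_def nonvanishing_map_iff)
    qed
  qed
  moreover have "inj_on (root_map d l \<mu> m x) {1..Suc l}" if x: "x \<in> topspace M" for x
  proof (rule inj_onI)
    fix r s assume rs: "r \<in> {1..Suc l}" "s \<in> {1..Suc l}"
      and eq: "root_map d l \<mu> m x r = root_map d l \<mu> m x s"
    have nz: "\<mu> (r - 1) * monomial d (m (r - 1)) x \<noteq> 0" if "r \<in> {1..Suc l}" "r \<noteq> 1" for r
    proof -
      have "r - 1 \<in> {1..l}"
        using that by auto
      then show ?thesis
        using nonvanishing_map_root[of "r - 1"] x unfolding nonvanishing_map_iff by blast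
    qed
    show "r = s"
    proof (cases "r = 1 \<or> s = 1")
      case True
      then show ?thesis
        using rs eq nz[of r] nz[of s] by (auto simp: root_map_def split: if_splits)
    next
      case False
      then have r1: "r - 1 \<in> {1..l}" and s1: "s - 1 \<in> {1..l}"
        using rs by auto
      have "r - 1 = s - 1"
        using roots_distinct[OF x r1 s1] eq rs False by (auto simp: root_map_def)
      then show ?thesis
        using False rs by auto
    qed
  qed
  ultimately show ?thesis
    unfolding Conf_def continuous_map_in_subtopology by (intro conjI funcsetI CollectI)
qed

text \<open>With equal exponents the two graphs differ only in the constant factor. Distinct
  hypersurfaces have distinct factors, and then the graphs are disjoint.\<close>

lemma meet_components_parallel:
  assumes ij: "i \<in> {1..l}" "j \<in> {1..l}" "i \<noteq> j" and par: "\<And>k. k \<in> {1..d} \<Longrightarrow> m i k = m j k"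
  shows "\<mu> i \<noteq> \<mu> j" "meet_components d Hs i j = {}"
proof -
  have mono: "monomial d (m i) x = monomial d (m j) x" for x
    by (rule monomial_cong[OF par])
  show "\<mu> i \<noteq> \<mu> j"
    using Hs_distinct[OF ij] unfolding Hs_eq[OF ij(1)] Hs_eq[OF ij(2)] mono by auto
  then have "proj d ` (Hs i \<inter> Hs j) = {}"
    unfolding proj_intersection[OF ij(1,2)] mono using monomial_nonzero by auto
  then show "meet_components d Hs i j = {}"
    by (simp add: meet_components_def connected_components_of_eq_empty)
qed

text \<open>
  A component \<open>x\<^sup>a = \<rho>\<close> whose chosen equation is the one for \<open>- a\<close> contributes an additional factor
  \<open>x\<^sup>a\<close>; this accounts for the term \<open>(m(i, j) - s(i, j)) a\<close> of \<open>\<nu>(i, j)\<close>.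
\<close>

lemma dlog_pairing_component:
  assumes \<gamma>: "\<gamma> \<in> carrier (homology_group 1 M)"
    and a: "Gcd (a ` {1..d}) = 1" and "\<rho> \<noteq> 0" and H: "level_set d a \<rho> \<in> \<B>"
  shows "dlog_pairing (\<lambda>x. monomial d a x - \<rho>) \<gamma>
    = dlog_pairing (defining_map (level_set d a \<rho>)) \<gamma>
      + (if \<forall>k\<in>{1..d}. mH (level_set d a \<rho>) k = a k then 0 else dlog_pairing (monomial d a) \<gamma>)"
    and "nonvanishing_map M (\<lambda>x. monomial d a x - \<rho>)"
proof -
  let ?H = "level_set d a \<rho>"
  have "level_set d a \<rho> \<subseteq> level_set d (mH ?H) (\<mu>H ?H)"
    using B_eq[OF H] by (rule equalityD1)
  then consider (pos) "\<And>k. k \<in> {1..d} \<Longrightarrow> mH ?H k = a k" "\<mu>H ?H = \<rho>"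
    | (neg) "\<And>k. k \<in> {1..d} \<Longrightarrow> mH ?H k = - a k" "\<mu>H ?H = inverse \<rho>"
    using level_set_subset_imp[OF a B_primitive[OF H] \<open>\<rho> \<noteq> 0\<close>] by blast
  then have "dlog_pairing (\<lambda>x. monomial d a x - \<rho>) \<gamma> = dlog_pairing (defining_map ?H) \<gamma>
        + (if \<forall>k\<in>{1..d}. mH ?H k = a k then 0 else dlog_pairing (monomial d a) \<gamma>)
      \<and> nonvanishing_map M (\<lambda>x. monomial d a x - \<rho>)"
  proof cases
    case pos
    have "monomial d (mH ?H) x = monomial d a x" for x
      by (rule monomial_cong[OF pos(1)])
    then have "defining_map ?H = (\<lambda>x. monomial d a x - \<rho>)"
      using pos(2) by simp
    then show ?thesis
      using pos(1) nonvanishing_defining_map[OF H] by simp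
  next
    case neg
    \<comment> \<open>A primitive vector is nonzero, since a family of zeros has gcd 0. So
      \<open>a\<close> and \<open>- a\<close> differ, and the conditional in the claim takes its
      second branch.\<close>
    have "\<exists>k\<in>{1..d}. a k \<noteq> 0"
    proof (rule ccontr)
      assume "\<not> (\<exists>k\<in>{1..d}. a k \<noteq> 0)"
      then have "Gcd (a ` {1..d}) = 0"
        by (simp add: Gcd_0_iff image_subset_iff)
      then show False
        using a by simp
    qed
    then have not_pos: "\<not> (\<forall>k\<in>{1..d}. mH ?H k = a k)"
      using neg(1) by force
    have mono: "monomial d (mH ?H) x = inverse (monomial d a x)" for x
      using monomial_cong[of d "mH ?H" "\<lambda>k. - a k", OF neg(1)] monomial_minus by simp
    \<comment> \<open>Here the chosen equation is \<open>x^(-a) - 1/\<rho>\<close>; multiplying it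
      by \<open>- \<rho> * x^a\<close> returns \<open>x^a - \<rho>\<close>.\<close>
    let ?u = "\<lambda>x. - \<rho> * (monomial d a x * defining_map ?H x)"
    have na: "nonvanishing_map M (monomial d a)"
      by (intro nonvanishing_map_complement nonvanishing_map_monomial)
    have nH: "nonvanishing_map M (defining_map ?H)"
      by (rule nonvanishing_defining_map[OF H])
    have nc: "nonvanishing_map M (\<lambda>_. - \<rho>)"
      using \<open>\<rho> \<noteq> 0\<close> by (intro nonvanishing_map_const) simp
    have eq: "monomial d a x - \<rho> = ?u x" if "x \<in> topspace M" for x
    proof -
      have "monomial d a x \<noteq> 0"
        using na that unfolding nonvanishing_map_iff by blast
      then show ?thesis
        unfolding mono neg(2) using \<open>\<rho> \<noteq> 0\<close> by (simp add: field_simps)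
    qed
    have nu: "nonvanishing_map M ?u"
      by (intro nonvanishing_map_mult na nH nc)
    have "nonvanishing_map M (\<lambda>x. monomial d a x - \<rho>)"
      by (rule continuous_map_eq[OF nu eq[symmetric]])
    moreover have "dlog_pairing (\<lambda>x. monomial d a x - \<rho>) \<gamma> = dlog_pairing ?u \<gamma>"
      by (intro dlog_pairing_cong[OF _ \<gamma>] eq)
    moreover have "dlog_pairing ?u \<gamma> = dlog_pairing (\<lambda>_. - \<rho>) \<gamma>
        + dlog_pairing (\<lambda>x. monomial d a x * defining_map ?H x) \<gamma>"
      by (intro dlog_pairing_mult[OF nc _ \<gamma>] nonvanishing_map_mult na nH)
    moreover have "dlog_pairing (\<lambda>_. - \<rho>) \<gamma> = 0"
      using \<open>\<rho> \<noteq> 0\<close> by (intro dlog_pairing_const) simp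
    moreover have "dlog_pairing (\<lambda>x. monomial d a x * defining_map ?H x) \<gamma>
        = dlog_pairing (monomial d a) \<gamma> + dlog_pairing (defining_map ?H) \<gamma>"
      by (rule dlog_pairing_mult[OF na nH \<gamma>])
    ultimately show ?thesis
      unfolding if_not_P[OF not_pos] by simp
  qed
  then show "dlog_pairing (\<lambda>x. monomial d a x - \<rho>) \<gamma> = dlog_pairing (defining_map ?H) \<gamma>
      + (if \<forall>k\<in>{1..d}. mH ?H k = a k then 0 else dlog_pairing (monomial d a) \<gamma>)"
    "nonvanishing_map M (\<lambda>x. monomial d a x - \<rho>)"
    by blast+
qed

text \<open>Since \<open>m j = m i + N * a\<close> on the coordinates, dividing the equality of
  roots by \<open>x^(m i)\<close> turns it into \<open>(x^a)^N = c\<close>. Primitivity of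
  \<open>a\<close> then separates the solution set into one component for each \<open>N\<close>-th
  root of \<open>c\<close>.\<close>

lemma meet_components_nonparallel:
  assumes ij: "i \<in> {1..l}" "j \<in> {1..l}" "i \<noteq> j"
    and nonpar: "\<exists>k\<in>{1..d}. m i k \<noteq> m j k"
  defines "N \<equiv> nat (gcd_diff d m i j)" and "a \<equiv> prim_dir d m i j" and "c \<equiv> \<mu> i / \<mu> j"
  shows "Gcd (a ` {1..d}) = 1" and "N > 0" and "c \<noteq> 0" and "int N = gcd_diff d m i j"
    and "\<And>x. x \<in> topspace (torus d) \<Longrightarrow> monomial d (m j) x = monomial d (m i) x * monomial d a x ^ N"
    and "meet_components d Hs i j = level_set d a ` {\<rho>. \<rho> ^ N = c}"
    and "meet_components d Hs i j \<subseteq> \<B>"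
proof -
  have g0: "gcd_diff d m i j \<noteq> 0"
    using nonpar by (auto simp: gcd_diff_def)
  moreover have "gcd_diff d m i j \<ge> 0"
    by (simp add: gcd_diff_def)
  ultimately have g: "int N = gcd_diff d m i j" and "N > 0"
    by (auto simp: N_def)
  show "int N = gcd_diff d m i j" "N > 0"
    by fact+
  show a: "Gcd (a ` {1..d}) = 1"
    using Gcd_image_div_Gcd[of "\<lambda>k. m j k - m i k" "{1..d}"] g0
    unfolding a_def prim_dir_def[abs_def] gcd_diff_def by blast
  show c: "c \<noteq> 0"
    using mu_nonzero ij by (simp add: c_def)
  show mono: "monomial d (m j) x = monomial d (m i) x * monomial d a x ^ N"
    if x: "x \<in> topspace (torus d)" for x
  proof -
    have "m j k = m i k + int N * a k" if "k \<in> {1..d}" for k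
    proof -
      have "gcd_diff d m i j dvd m j k - m i k"
        unfolding gcd_diff_def using that by (intro Gcd_dvd imageI)
      then show ?thesis
        by (simp add: g a_def prim_dir_def)
    qed
    then have "monomial d (m j) x = monomial d (\<lambda>k. m i k + int N * a k) x"
      by (rule monomial_cong)
    then show ?thesis
      using monomial_times_const[of "int N" d a x] by (simp add: monomial_add[OF x])
  qed
  have proj_eq: "proj d ` (Hs i \<inter> Hs j) = {x \<in> topspace (torus d). monomial d a x ^ N = c}"
    unfolding proj_intersection[OF ij(1,2)]
  proof (intro Collect_cong conj_cong refl)
    fix x assume x: "x \<in> topspace (torus d)"
    show "(\<mu> j * monomial d (m j) x = \<mu> i * monomial d (m i) x) = (monomial d a x ^ N = c)"
      using monomial_nonzero[OF x, of "m i"] mu_nonzero[OF ij(2)]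
      unfolding mono[OF x] c_def by (auto simp: field_simps)
  qed
  show comps: "meet_components d Hs i j = level_set d a ` {\<rho>. \<rho> ^ N = c}"
    unfolding meet_components_def proj_eq
    by (rule connected_components_of_power_level_set[OF a c \<open>N > 0\<close>])
  show "meet_components d Hs i j \<subseteq> \<B>"
    unfolding comps
  proof (rule image_subsetI)
    fix \<rho> assume \<rho>: "\<rho> \<in> {\<rho>. \<rho> ^ N = c}"
    then have "\<rho> \<noteq> 0"
      using c \<open>N > 0\<close> by auto
    have sub: "level_set d a \<rho> \<subseteq> proj d ` (Hs i \<inter> Hs j)"
      using \<rho> unfolding proj_eq by (auto simp: level_set_def)
    obtain H where H: "H \<in> \<B>" "level_set d a \<rho> \<subseteq> H"
      by (rule connected_subset_intersection_in_B[OF ij connectedin_level_set[OF a] sub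
            level_set_nonempty[OF a \<open>\<rho> \<noteq> 0\<close>]])
    \<comment> \<open>The covering hypersurface \<open>H\<close> is so far only known to contain the
      component. Both are level sets of primitive characters, so the containment forces them to
      coincide.\<close>
    have "level_set d a \<rho> \<subseteq> level_set d (mH H) (\<mu>H H)"
      using H(2) by (subst B_eq[OF H(1), symmetric])
    then have "level_set d (mH H) (\<mu>H H) = level_set d a \<rho>"
    proof (rule disjE[OF level_set_subset_imp[OF a B_primitive[OF H(1)] \<open>\<rho> \<noteq> 0\<close>]])
      assume eq: "(\<forall>k\<in>{1..d}. mH H k = a k) \<and> \<mu>H H = \<rho>"
      then have "monomial d (mH H) x = monomial d a x" for x
        by (intro monomial_cong) simp
      then show ?thesis
        using eq by (simp add: level_set_def)
    next
      assume eq: "(\<forall>k\<in>{1..d}. mH H k = - a k) \<and> \<mu>H H = inverse \<rho>"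
      then have "monomial d (mH H) x = monomial d (\<lambda>k. - a k) x" for x
        by (intro monomial_cong) simp
      then show ?thesis
        using eq by (simp add: level_set_def monomial_minus)
    qed
    then have "H = level_set d a \<rho>"
      using B_eq[OF H(1)] by (rule trans[rotated])
    then show "level_set d a \<rho> \<in> \<B>"
      using H(1) by simp
  qed
qed

lemma finite_meet_components:
  assumes "i \<in> {1..l}" "j \<in> {1..l}" "i \<noteq> j"
  shows "finite (meet_components d Hs i j)" "meet_components d Hs i j \<subseteq> \<B>"
proof -
  have "finite (meet_components d Hs i j) \<and> meet_components d Hs i j \<subseteq> \<B>"
  proof (cases "\<exists>k\<in>{1..d}. m i k \<noteq> m j k")
    case True
    have "finite {\<rho> :: complex. \<rho> ^ nat (gcd_diff d m i j) = \<mu> i / \<mu> j}"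
      using card_nth_roots[OF meet_components_nonparallel(3,2)[OF assms True]]
        meet_components_nonparallel(2)[OF assms True]
      by (intro card_ge_0_finite) (simp only:)
    then show ?thesis
      using meet_components_nonparallel(6,7)[OF assms True] by simp
  next
    case False
    then have "meet_components d Hs i j = {}"
      by (intro meet_components_parallel[OF assms]) blast
    then show ?thesis
      by simp
  qed
  then show "finite (meet_components d Hs i j)" "meet_components d Hs i j \<subseteq> \<B>"
    by blast+
qed

text \<open>For distinct exponents the difference equals \<open>\<mu> j * x^(m i)\<close> times the
  product of \<open>x^a - \<rho>\<close> over \<open>\<rho>^N = \<mu> i / \<mu> j\<close>. For equal
  exponents it is a nonzero constant times \<open>x^(m i)\<close>, and there are no
  components.\<close>

lemma dlog_pairing_root_difference:
  assumes \<gamma>: "\<gamma> \<in> carrier (homology_group 1 M)"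
    and ij: "i \<in> {1..l}" "j \<in> {1..l}" "i \<noteq> j"
  shows "dlog_pairing (\<lambda>x. \<mu> j * monomial d (m j) x - \<mu> i * monomial d (m i) x) \<gamma>
    = (\<Sum>k\<in>{1..d}. of_int (nu d Hs m mH i j k) * dlog_pairing (\<lambda>x. x k) \<gamma>)
      + (\<Sum>H\<in>meet_components d Hs i j. dlog_pairing (defining_map H) \<gamma>)"
proof -
  have mono: "nonvanishing_map M (monomial d e)" for e
    by (intro nonvanishing_map_complement nonvanishing_map_monomial)
  show ?thesis
  proof (cases "\<exists>k\<in>{1..d}. m i k \<noteq> m j k")
    case False
    then have par: "m i k = m j k" if "k \<in> {1..d}" for k
      using that by blast
    have "monomial d (m j) x = monomial d (m i) x" for x
      by (rule monomial_cong) (simp add: par)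
    then have "dlog_pairing (\<lambda>x. \<mu> j * monomial d (m j) x - \<mu> i * monomial d (m i) x) \<gamma>
        = dlog_pairing (\<lambda>x. (\<mu> j - \<mu> i) * monomial d (m i) x) \<gamma>"
      by (simp add: left_diff_distrib)
    also have "\<dots> = dlog_pairing (\<lambda>_. \<mu> j - \<mu> i) \<gamma> + dlog_pairing (monomial d (m i)) \<gamma>"
      using meet_components_parallel(1)[OF ij par]
      by (intro dlog_pairing_mult[OF _ mono \<gamma>] nonvanishing_map_const) simp
    also have "dlog_pairing (\<lambda>_. \<mu> j - \<mu> i) \<gamma> = 0"
      using meet_components_parallel(1)[OF ij par] by (intro dlog_pairing_const) simp
    also have "dlog_pairing (monomial d (m i)) \<gamma>
        = (\<Sum>k\<in>{1..d}. of_int (nu d Hs m mH i j k) * dlog_pairing (\<lambda>x. x k) \<gamma>)"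
      unfolding dlog_pairing_monomial[OF \<gamma>]
      by (intro sum.cong refl) (simp add: nu_def par)
    finally have D: "dlog_pairing (\<lambda>x. \<mu> j * monomial d (m j) x - \<mu> i * monomial d (m i) x) \<gamma>
        = 0 + (\<Sum>k\<in>{1..d}. of_int (nu d Hs m mH i j k) * dlog_pairing (\<lambda>x. x k) \<gamma>)" .
    have empty: "meet_components d Hs i j = {}"
      using par by (rule meet_components_parallel(2)[OF ij])
    show ?thesis
      unfolding empty D by simp
  next
    case True
    define N a c where "N = nat (gcd_diff d m i j)" and "a = prim_dir d m i j"
      and "c = \<mu> i / \<mu> j"
    define R where "R = {\<rho>. \<rho> ^ N = c}"
    note np = meet_components_nonparallel[OF ij True, folded N_def a_def c_def, folded R_def]
    let ?D = "\<lambda>f. dlog_pairing f \<gamma>"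
    let ?P = "\<lambda>\<rho>. \<forall>k\<in>{1..d}. mH (level_set d a \<rho>) k = a k"
    have card_R: "card R = N"
      unfolding R_def by (rule card_nth_roots[OF np(3,2)])
    then have fin_R: "finite R"
      using np(2) card_ge_0_finite by metis
    have R0: "\<rho> \<noteq> 0" if "\<rho> \<in> R" for \<rho>
      using that np(2,3) by (auto simp: R_def)
    have RB: "level_set d a \<rho> \<in> \<B>" if "\<rho> \<in> R" for \<rho>
      using that np(6,7) by blast
    have inj: "inj_on (level_set d a) R"
      using inj_on_level_set[OF np(1)] by (rule inj_on_subset) (use R0 in blast)
    note comp = dlog_pairing_component[OF \<gamma> np(1) R0 RB]

    \<comment> \<open>The factorization splits powers of coordinates and so holds only where these
      are nonzero; congruence on \<open>topspace M\<close> is what is needed.\<close>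
    have "?D (\<lambda>x. \<mu> j * monomial d (m j) x - \<mu> i * monomial d (m i) x)
        = ?D (\<lambda>x. \<mu> j * (monomial d (m i) x * (\<Prod>\<rho>\<in>R. monomial d a x - \<rho>)))"
    proof (rule dlog_pairing_cong[OF _ \<gamma>])
      fix x assume "x \<in> topspace M"
      then have x: "x \<in> topspace (torus d)"
        by (simp add: topspace_M)
      show "\<mu> j * monomial d (m j) x - \<mu> i * monomial d (m i) x
          = \<mu> j * (monomial d (m i) x * (\<Prod>\<rho>\<in>R. monomial d a x - \<rho>))"
        unfolding R_def prod_minus_nth_roots[OF np(3,2)] np(5)[OF x]
        using mu_nonzero[OF ij(2)] by (simp add: c_def field_simps)
    qed
    also have "\<dots> = ?D (\<lambda>_. \<mu> j) + ?D (\<lambda>x. monomial d (m i) x * (\<Prod>\<rho>\<in>R. monomial d a x - \<rho>))"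
      by (intro dlog_pairing_mult[OF _ _ \<gamma>] nonvanishing_map_const mu_nonzero ij
          nonvanishing_map_mult mono nonvanishing_map_prod comp)
    also have "?D (\<lambda>_. \<mu> j) = 0"
      by (rule dlog_pairing_const[OF mu_nonzero[OF ij(2)]])
    also have "?D (\<lambda>x. monomial d (m i) x * (\<Prod>\<rho>\<in>R. monomial d a x - \<rho>))
        = ?D (monomial d (m i)) + ?D (\<lambda>x. \<Prod>\<rho>\<in>R. monomial d a x - \<rho>)"
      by (intro dlog_pairing_mult[OF _ _ \<gamma>] mono nonvanishing_map_prod comp)
    also have "?D (\<lambda>x. \<Prod>\<rho>\<in>R. monomial d a x - \<rho>) = (\<Sum>\<rho>\<in>R. ?D (\<lambda>x. monomial d a x - \<rho>))"
      by (intro dlog_pairing_prod[OF _ \<gamma>] comp)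
    also have "\<dots> = (\<Sum>\<rho>\<in>R. ?D (defining_map (level_set d a \<rho>)))
        + (\<Sum>\<rho>\<in>R. if ?P \<rho> then 0 else ?D (monomial d a))"
      unfolding sum.distrib[symmetric] by (intro sum.cong refl comp)
    also have "(\<Sum>\<rho>\<in>R. ?D (defining_map (level_set d a \<rho>)))
        = (\<Sum>H\<in>meet_components d Hs i j. ?D (defining_map H))"
      unfolding np(6) sum.reindex[OF inj] by simp
    \<comment> \<open>There are \<open>N\<close> roots, one for each component. Those counted by
      \<open>pos_count\<close> contribute nothing, and each of the others contributes one copy of
      the pairing with \<open>x^a\<close>.\<close>
    also have "(\<Sum>\<rho>\<in>R. if ?P \<rho> then 0 else ?D (monomial d a))
        = of_int (gcd_diff d m i j - int (pos_count d Hs m mH i j)) * ?D (monomial d a)"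
    proof -
      have "{H \<in> meet_components d Hs i j. \<forall>k\<in>{1..d}. mH H k = a k}
          = level_set d a ` {\<rho>\<in>R. ?P \<rho>}"
        unfolding np(6) by blast
      then have pos: "pos_count d Hs m mH i j = card {\<rho>\<in>R. ?P \<rho>}"
        unfolding pos_count_def a_def[symmetric]
        using inj_on_subset[OF inj] by (simp add: card_image)
      have "card R = card {\<rho>\<in>R. ?P \<rho>} + card {\<rho>\<in>R. \<not> ?P \<rho>}"
        using fin_R by (subst card_Un_disjoint[symmetric]) (auto intro: arg_cong[where f = card])
      then have neg: "int (card {\<rho>\<in>R. \<not> ?P \<rho>}) = gcd_diff d m i j - int (pos_count d Hs m mH i j)"
        using pos card_R np(4) by linarith
      have "(\<Sum>\<rho>\<in>R. if ?P \<rho> then 0 else ?D (monomial d a))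
          = (\<Sum>\<rho>\<in>{\<rho>\<in>R. \<not> ?P \<rho>}. ?D (monomial d a))"
        using fin_R by (intro sum.mono_neutral_cong_right) auto
      also have "\<dots> = of_int (int (card {\<rho>\<in>R. \<not> ?P \<rho>})) * ?D (monomial d a)"
        by simp
      finally show ?thesis
        unfolding neg .
    qed
    also have "?D (monomial d (m i)) = (\<Sum>k\<in>{1..d}. of_int (m i k) * ?D (\<lambda>x. x k))"
      by (rule dlog_pairing_monomial[OF \<gamma>])
    also have "?D (monomial d a) = (\<Sum>k\<in>{1..d}. of_int (a k) * ?D (\<lambda>x. x k))"
      by (rule dlog_pairing_monomial[OF \<gamma>])
    also have "0 + ((\<Sum>k\<in>{1..d}. of_int (m i k) * ?D (\<lambda>x. x k))
          + ((\<Sum>H\<in>meet_components d Hs i j. ?D (defining_map H))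
            + of_int (gcd_diff d m i j - int (pos_count d Hs m mH i j))
              * (\<Sum>k\<in>{1..d}. of_int (a k) * ?D (\<lambda>x. x k))))
        = (\<Sum>k\<in>{1..d}. of_int (m i k + (gcd_diff d m i j - int (pos_count d Hs m mH i j)) * a k)
              * ?D (\<lambda>x. x k))
          + (\<Sum>H\<in>meet_components d Hs i j. ?D (defining_map H))"
      by (simp add: sum_distrib_left distrib_right sum.distrib mult.assoc)
    also have "(\<Sum>k\<in>{1..d}. of_int (m i k + (gcd_diff d m i j - int (pos_count d Hs m mH i j)) * a k)
              * ?D (\<lambda>x. x k))
        = (\<Sum>k\<in>{1..d}. of_int (nu d Hs m mH i j k) * ?D (\<lambda>x. x k))"
    proof -
      have "\<not> (\<forall>k\<in>{1..d}. m i k = m j k)"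
        using True by blast
      then show ?thesis
        by (simp only: nu_def a_def if_False)
    qed
    finally show ?thesis .
  qed
qed

end

section \<open>Pulling back the forms of the configuration space and comparing coefficients\<close>

lemma nonvanishing_map_Conf:
  assumes "r \<in> {1..n}" "s \<in> {1..n}" "r \<noteq> s"
  shows "nonvanishing_map (Conf n) (\<lambda>z. z s - z r)"
  unfolding nonvanishing_map_iff
proof
  have "continuous_map (Conf n) euclidean (\<lambda>z. z k)" if "k \<in> {1..n}" for k
    unfolding Conf_def
    by (intro continuous_map_from_subtopology continuous_map_product_projection that)
  then show "continuous_map (Conf n) euclidean (\<lambda>z. z s - z r)"
    using assms by (intro continuous_map_diff)
  show "\<forall>z\<in>topspace (Conf n). z s - z r \<noteq> 0"
  proof
    fix z assume "z \<in> topspace (Conf n)"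
    then have "inj_on z {1..n}"
      by (simp add: Conf_def)
    then show "z s - z r \<noteq> 0"
      using inj_on_eq_iff[of z "{1..n}" s r] assms by simp
  qed
qed

text \<open>By naturality the form is evaluated on the composite with the root map. Because of the
  zero in coordinate 1, this is a single root for \<open>r = 1\<close> and otherwise the difference
  of the roots numbered \<open>s - 1\<close> and \<open>r - 1\<close>.\<close>

lemma (in corank_one_arrangement) dlog_pairing_root_map:
  assumes \<gamma>: "\<gamma> \<in> carrier (homology_group 1 M)" and rs: "1 \<le> r" "r < s" "s \<le> Suc l"
  shows "dlog_pairing (\<lambda>z. z s - z r)
      (hom_induced 1 M {} (Conf (Suc l)) {} (root_map d l \<mu> m) \<gamma>)
    = (if r = 1 then \<Sum>k\<in>{1..d}. of_int (m (s - 1) k) * dlog_pairing (\<lambda>x. x k) \<gamma>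
       else (\<Sum>k\<in>{1..d}. of_int (nu d Hs m mH (r - 1) (s - 1) k) * dlog_pairing (\<lambda>x. x k) \<gamma>)
         + (\<Sum>H\<in>meet_components d Hs (r - 1) (s - 1). dlog_pairing (defining_map H) \<gamma>))"
proof -
  have s: "s - 1 \<in> {1..l}" "s \<noteq> 1"
    using rs by auto
  have "nonvanishing_map (Conf (Suc l)) (\<lambda>z. z s - z r)"
    using rs by (intro nonvanishing_map_Conf) auto
  then have eq: "dlog_pairing (\<lambda>z. z s - z r)
      (hom_induced 1 M {} (Conf (Suc l)) {} (root_map d l \<mu> m) \<gamma>)
    = dlog_pairing ((\<lambda>z. z s - z r) \<circ> root_map d l \<mu> m) \<gamma>"
    by (rule dlog_pairing_hom_induced[OF continuous_map_root_map _ \<gamma>])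
  show ?thesis
  proof (cases "r = 1")
    case True
    have "(\<lambda>z. z s - z r) \<circ> root_map d l \<mu> m = (\<lambda>x. \<mu> (s - 1) * monomial d (m (s - 1)) x)"
      using rs s True by (auto simp: root_map_def)
    then have "dlog_pairing ((\<lambda>z. z s - z r) \<circ> root_map d l \<mu> m) \<gamma>
        = dlog_pairing (\<lambda>_. \<mu> (s - 1)) \<gamma> + dlog_pairing (monomial d (m (s - 1))) \<gamma>"
      using dlog_pairing_mult[OF nonvanishing_map_const[OF mu_nonzero[OF s(1)]]
          nonvanishing_map_complement[OF nonvanishing_map_monomial] \<gamma>] by simp
    then show ?thesis
      unfolding eq if_P[OF True] dlog_pairing_monomial[OF \<gamma>] dlog_pairing_const[OF mu_nonzero[OF s(1)]]
      by simp
  next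
    case False
    then have r: "r - 1 \<in> {1..l}" "r - 1 \<noteq> s - 1"
      using rs by auto
    have "(\<lambda>z. z s - z r) \<circ> root_map d l \<mu> m = (\<lambda>x. \<mu> (s - 1) * monomial d (m (s - 1)) x
        - \<mu> (r - 1) * monomial d (m (r - 1)) x)"
      using rs s False by (auto simp: root_map_def)
    then show ?thesis
      using False by (simp only: eq dlog_pairing_root_difference[OF \<gamma> r(1) s(1) r(2)] if_False)
  qed
qed

theorem theorem6p2p2:
  fixes d l n :: nat
    and \<A> \<B> :: "(nat \<Rightarrow> complex) set set"
    and Hs :: "nat \<Rightarrow> (nat \<Rightarrow> complex) set"
    and m :: "nat \<Rightarrow> nat \<Rightarrow> int"
    and \<mu> :: "nat \<Rightarrow> complex"
    and mH :: "(nat \<Rightarrow> complex) set \<Rightarrow> nat \<Rightarrow> int"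
    and \<mu>H :: "(nat \<Rightarrow> complex) set \<Rightarrow> complex"
    and X :: "nat \<Rightarrow> (nat \<Rightarrow> complex) chain set"
    and XH :: "(nat \<Rightarrow> complex) set \<Rightarrow> (nat \<Rightarrow> complex) chain set"
    and A :: "nat \<Rightarrow> nat \<Rightarrow> (nat \<Rightarrow> complex) chain set"
  assumes arrangement: "toric_arrangement (Suc d) \<A>"
    and essential: "essential (Suc d) \<A>"
    and TM_ideal: "corank_one_TM_ideal (Suc d) (last_coord_subgroup d) \<A>"
    and enumeration:
      "bij_betw Hs {1..l} (\<A> - sub_arrangement (Suc d) (last_coord_subgroup d) \<A>)"
    and B: "\<B> = quotient_arrangement d \<A>"
    and n: "n = l + 1"
    and Hs_equation: "\<And>j. j \<in> {1..l} \<Longrightarrow> root_of_unity (\<mu> j) \<and>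
      Hs j = {t \<in> topspace (torus (Suc d)). t (Suc d) = \<mu> j * monomial d (m j) t}"
    and B_equation: "\<And>H. H \<in> \<B> \<Longrightarrow> root_of_unity (\<mu>H H) \<and> Gcd (mH H ` {1..d}) = 1 \<and>
      H = {x \<in> topspace (torus d). monomial d (mH H) x - \<mu>H H = 0}"
    and X_basis: "dual_basis_H1 (complement_space d \<B>) ({1..d} <+> \<B>)
      (case_sum (\<lambda>k x. x k) (\<lambda>H x. monomial d (mH H) x - \<mu>H H)) (case_sum X XH)"
    and A_basis: "dual_basis_H1 (Conf n) {(r, s). 1 \<le> r \<and> r < s \<and> s \<le> n}
      (\<lambda>(r, s) z. z s - z r) (\<lambda>(r, s). A r s)"
  shows "(\<forall>k\<in>{1..d}.
        hom_induced 1 (complement_space d \<B>) {} (Conf n) {} (root_map d l \<mu> m) (X k) =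
        (\<Otimes>\<^bsub>H1_Conf n\<^esub>j\<in>{1..n-1}. A 1 (j + 1) [^]\<^bsub>H1_Conf n\<^esub> m j k \<otimes>\<^bsub>H1_Conf n\<^esub>
          (\<Otimes>\<^bsub>H1_Conf n\<^esub>i\<in>{1..j-1}. A (i + 1) (j + 1) [^]\<^bsub>H1_Conf n\<^esub> nu d Hs m mH i j k)))
    \<and> (\<forall>H\<in>\<B>.
        hom_induced 1 (complement_space d \<B>) {} (Conf n) {} (root_map d l \<mu> m) (XH H) =
        (\<Otimes>\<^bsub>H1_Conf n\<^esub>p\<in>{(i, j). 1 \<le> i \<and> i < j \<and> j \<le> l \<and> H \<in> meet_components d Hs i j}.
          A (fst p + 1) (snd p + 1)))"
proof -
  interpret corank_one_arrangement d l \<A> \<B> Hs m \<mu> mH \<mu>H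
  proof (rule corank_one_arrangement.intro[OF TM_ideal enumeration B])
    show "root_of_unity (\<mu> j)"
      and "Hs j = {t \<in> topspace (torus (Suc d)). t (Suc d) = \<mu> j * monomial d (m j) t}"
      if "j \<in> {1..l}" for j
      by (fact conjunct1[OF Hs_equation[OF that]] conjunct2[OF Hs_equation[OF that]])+
    show "Gcd (mH H ` {1..d}) = 1" if "H \<in> \<B>" for H
      by (fact conjunct1[OF conjunct2[OF B_equation[OF that]]])
    show "H = level_set d (mH H) (\<mu>H H)" if "H \<in> \<B>" for H
      unfolding level_set_def
      using conjunct2[OF conjunct2[OF B_equation[OF that]]] by (simp only: right_minus_eq)
  qed
  interpret comm_group "H1_Conf n"
    by (rule comm_group_homology_group_1)
  let ?I = "{(r, s). 1 \<le> r \<and> r < s \<and> s \<le> n}"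
  let ?b = "hom_induced 1 M {} (Conf n) {} (root_map d l \<mu> m)"
  let ?f = "\<lambda>r s z. z s - z r :: complex"
  have n_eq: "n = Suc l"
    using n by simp
  have "?I \<subseteq> {1..n} \<times> {1..n}"
    by auto
  then have fin: "finite ?I"
    by (rule finite_subset) simp
  have nv: "nonvanishing_map (Conf n) (?f r s)" if "1 \<le> r" "r < s" "s \<le> n" for r s
    using that by (intro nonvanishing_map_Conf) auto
  have A_closed: "A r s \<in> carrier (H1_Conf n)" if "1 \<le> r" "r < s" "s \<le> n" for r s
    using dual_basis_H1_closed[OF A_basis, of "(r, s)"] that by simp
  have A_dual: "dlog_pairing (?f r s) (A r' s') = (if r = r' \<and> s = s' then 1 else 0)"
    if "1 \<le> r" "r < s" "s \<le> n" "1 \<le> r'" "r' < s'" "s' \<le> n" for r s r' s'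
    using dual_basis_H1_pairing[OF A_basis, of "(r, s)" "(r', s')"] that by simp
  have eqI: "\<alpha> = \<beta>"
    if "\<alpha> \<in> carrier (H1_Conf n)" "\<beta> \<in> carrier (H1_Conf n)"
      and eq: "\<And>r s. 1 \<le> r \<Longrightarrow> r < s \<Longrightarrow> s \<le> n \<Longrightarrow> dlog_pairing (?f r s) \<alpha> = dlog_pairing (?f r s) \<beta>"
    for \<alpha> \<beta>
  proof (rule dual_basis_H1_eqI[OF A_basis fin _ that(1,2)])
    fix p assume "p \<in> ?I"
    then obtain r s where p: "p = (r, s)" "1 \<le> r" "r < s" "s \<le> n"
      by blast
    show "nonvanishing_map (Conf n) (case p of (r, s) \<Rightarrow> ?f r s)"
      using nv p by simp
    show "dlog_pairing (case p of (r, s) \<Rightarrow> ?f r s) \<alpha>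
        = dlog_pairing (case p of (r, s) \<Rightarrow> ?f r s) \<beta>"
      using eq p by simp
  qed
  have b_closed: "?b \<gamma> \<in> carrier (H1_Conf n)" for \<gamma>
    by (rule hom_induced_carrier)
  have X_closed: "case_sum X XH p \<in> carrier (homology_group 1 M)" if "p \<in> {1..d} <+> \<B>" for p
    by (rule dual_basis_H1_closed[OF X_basis that])
  have X_dual: "dlog_pairing (case_sum (\<lambda>k x. x k) defining_map p) (case_sum X XH q)
      = (if p = q then 1 else 0)" if "p \<in> {1..d} <+> \<B>" "q \<in> {1..d} <+> \<B>" for p q
    by (rule dual_basis_H1_pairing[OF X_basis that])

  show ?thesis
  proof (intro conjI ballI)

    \<comment> \<open>Images of the coordinate classes\<close>
    fix k assume k: "k \<in> {1..d}"
    let ?T = "\<lambda>j i. A (i + 1) (j + 1) [^]\<^bsub>H1_Conf n\<^esub> nu d Hs m mH i j k"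
    let ?U = "\<lambda>j. A 1 (j + 1) [^]\<^bsub>H1_Conf n\<^esub> m j k"
    have kI: "Inl k \<in> {1..d} <+> \<B>"
      using k by blast
    have Xk: "X k \<in> carrier (homology_group 1 M)"
      using X_closed[OF kI] by simp
    have Xk_coord: "dlog_pairing (\<lambda>x. x k') (X k) = (if k' = k then 1 else 0)" if "k' \<in> {1..d}" for k'
      using X_dual[OF InlI[OF that] kI] by simp
    have Xk_H: "dlog_pairing (defining_map H) (X k) = 0" if "H \<in> \<B>" for H
      using X_dual[OF InrI[OF that] kI] by simp
    have sum_coord: "(\<Sum>k'\<in>{1..d}. of_int (e k') * dlog_pairing (\<lambda>x. x k') (X k)) = of_int (e k)"
      for e
    proof -
      have "(\<Sum>k'\<in>{1..d}. of_int (e k') * dlog_pairing (\<lambda>x. x k') (X k))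
          = (\<Sum>k'\<in>{1..d}. if k' = k then of_int (e k') else 0)"
        by (intro sum.cong refl) (simp add: Xk_coord)
      then show ?thesis
        using k by simp
    qed
    have T_closed: "?T j i \<in> carrier (H1_Conf n)" if "j \<in> {1..n - 1}" "i \<in> {1..j - 1}" for i j
      using that n by (intro int_pow_closed A_closed) auto
    have U_closed: "?U j \<in> carrier (H1_Conf n)" if "j \<in> {1..n - 1}" for j
      using that n by (intro int_pow_closed A_closed) auto
    have prod_closed: "(\<Otimes>\<^bsub>H1_Conf n\<^esub>i\<in>{1..j-1}. ?T j i) \<in> carrier (H1_Conf n)"
      if "j \<in> {1..n - 1}" for j
      by (intro finprod_closed Pi_I T_closed that)
    have UT_closed: "?U j \<otimes>\<^bsub>H1_Conf n\<^esub> (\<Otimes>\<^bsub>H1_Conf n\<^esub>i\<in>{1..j-1}. ?T j i) \<in> carrier (H1_Conf n)"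
      if "j \<in> {1..n - 1}" for j
      by (intro m_closed U_closed prod_closed that)
    show "?b (X k) = (\<Otimes>\<^bsub>H1_Conf n\<^esub>j\<in>{1..n-1}. ?U j \<otimes>\<^bsub>H1_Conf n\<^esub>
        (\<Otimes>\<^bsub>H1_Conf n\<^esub>i\<in>{1..j-1}. ?T j i))"
    proof (rule eqI[OF b_closed])
      show "(\<Otimes>\<^bsub>H1_Conf n\<^esub>j\<in>{1..n-1}. ?U j \<otimes>\<^bsub>H1_Conf n\<^esub> (\<Otimes>\<^bsub>H1_Conf n\<^esub>i\<in>{1..j-1}. ?T j i))
          \<in> carrier (H1_Conf n)"
        by (intro finprod_closed Pi_I UT_closed)
      fix r s assume rs: "1 \<le> r" "r < s" "s \<le> n"
      note nvrs = nv[OF rs]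
      \<comment> \<open>The expected coefficient of \<open>A r s\<close>, after shifting both
        indices down by one.\<close>
      let ?F = "if r = 1 then m (s - 1) k else nu d Hs m mH (r - 1) (s - 1) k"
      have "dlog_pairing (?f r s) (?b (X k)) = of_int ?F"
      proof (cases "r = 1")
        case True
        then show ?thesis
          using dlog_pairing_root_map[OF Xk rs[unfolded n_eq]] by (simp only: sum_coord n_eq) simp
      next
        case False
        \<comment> \<open>Membership in \<open>\<B>\<close> lets duality annihilate the contribution
          of every component on \<open>X k\<close>.\<close>
        have "meet_components d Hs (r - 1) (s - 1) \<subseteq> \<B>"
          using rs n_eq False by (intro finite_meet_components(2)) auto
        then have "(\<Sum>H\<in>meet_components d Hs (r - 1) (s - 1). dlog_pairing (defining_map H) (X k)) = 0"
          by (intro sum.neutral ballI Xk_H) blast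
        then show ?thesis
          using dlog_pairing_root_map[OF Xk rs[unfolded n_eq]] False
          by (simp only: sum_coord n_eq if_False add_0_right)
      qed
      moreover have "dlog_pairing (?f r s) (\<Otimes>\<^bsub>H1_Conf n\<^esub>j\<in>{1..n-1}. ?U j \<otimes>\<^bsub>H1_Conf n\<^esub>
          (\<Otimes>\<^bsub>H1_Conf n\<^esub>i\<in>{1..j-1}. ?T j i)) = of_int ?F"
      proof -
        \<comment> \<open>Only the factor with \<open>j + 1 = s\<close> can pair nontrivially:
          through its leading term when \<open>r = 1\<close>, through the inner term
          \<open>i = r - 1\<close> otherwise.\<close>
        have summand: "dlog_pairing (?f r s) (?U j \<otimes>\<^bsub>H1_Conf n\<^esub> (\<Otimes>\<^bsub>H1_Conf n\<^esub>i\<in>{1..j-1}. ?T j i))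
            = (if j = s - 1 then of_int ?F else 0)" if j: "j \<in> {1..n - 1}" for j
        proof -
          have "dlog_pairing (?f r s) (?U j) = (if r = 1 \<and> s = j + 1 then of_int (m j k) else 0)"
          proof -
            have j1: "1 \<le> (1 :: nat)" "1 < j + 1" "j + 1 \<le> n"
              using j n by auto
            show ?thesis
              using A_dual[OF rs j1] by (simp add: dlog_pairing_group_int_pow[OF nvrs A_closed[OF j1]])
          qed
          moreover have "dlog_pairing (?f r s) (\<Otimes>\<^bsub>H1_Conf n\<^esub>i\<in>{1..j-1}. ?T j i)
              = (\<Sum>i\<in>{1..j-1}. if i = r - 1 \<and> s = j + 1 then of_int (nu d Hs m mH i j k) else 0)"
          proof -
            have "dlog_pairing (?f r s) (?T j i)
                = (if i = r - 1 \<and> s = j + 1 then of_int (nu d Hs m mH i j k) else 0)"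
              if i: "i \<in> {1..j-1}" for i
            proof -
              have ij: "1 \<le> i + 1" "i + 1 < j + 1" "j + 1 \<le> n"
                using i j n by auto
              have "(r = i + 1) = (i = r - 1)"
                using rs i by auto
              then show ?thesis
                using A_dual[OF rs ij] by (simp add: dlog_pairing_group_int_pow[OF nvrs A_closed[OF ij]])
            qed
            then have "(\<Sum>i\<in>{1..j-1}. dlog_pairing (?f r s) (?T j i))
                = (\<Sum>i\<in>{1..j-1}. if i = r - 1 \<and> s = j + 1 then of_int (nu d Hs m mH i j k) else 0)"
              by (rule sum.cong[OF refl])
            moreover have "dlog_pairing (?f r s) (\<Otimes>\<^bsub>H1_Conf n\<^esub>i\<in>{1..j-1}. ?T j i)
                = (\<Sum>i\<in>{1..j-1}. dlog_pairing (?f r s) (?T j i))"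
              by (intro dlog_pairing_finprod[OF nvrs] finite_atLeastAtMost T_closed[OF j])
            ultimately show ?thesis
              by (simp only:)
          qed
          moreover have "(\<Sum>i\<in>{1..j-1}. if i = r - 1 \<and> s = j + 1 then of_int (nu d Hs m mH i j k) else 0)
              = (if r \<noteq> 1 \<and> s = j + 1 then of_int (nu d Hs m mH (r - 1) j k) else (0 :: complex))"
          proof (cases "s = j + 1")
            case True
            \<comment> \<open>For \<open>r = 1\<close> the index \<open>r - 1\<close> is 0 and falls
              outside the range, so the inner and leading terms never contribute together.\<close>
            then have "r - 1 \<in> {1..j-1} \<longleftrightarrow> r \<noteq> 1"
              using rs by auto
            then show ?thesis
              using True by (simp add: sum.delta)
          qed simp
          moreover have "j = s - 1 \<longleftrightarrow> s = j + 1"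
            using rs by auto
          ultimately show ?thesis
            by (simp add: dlog_pairing_group_mult[OF nvrs U_closed[OF j] prod_closed[OF j]])
        qed
        have "dlog_pairing (?f r s) (\<Otimes>\<^bsub>H1_Conf n\<^esub>j\<in>{1..n-1}. ?U j \<otimes>\<^bsub>H1_Conf n\<^esub>
            (\<Otimes>\<^bsub>H1_Conf n\<^esub>i\<in>{1..j-1}. ?T j i))
            = (\<Sum>j\<in>{1..n-1}. dlog_pairing (?f r s) (?U j \<otimes>\<^bsub>H1_Conf n\<^esub>
                (\<Otimes>\<^bsub>H1_Conf n\<^esub>i\<in>{1..j-1}. ?T j i)))"
          by (intro dlog_pairing_finprod[OF nvrs] finite_atLeastAtMost UT_closed)
        also have "\<dots> = (\<Sum>j\<in>{1..n-1}. if j = s - 1 then of_int ?F else 0)"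
          by (intro sum.cong[OF refl] summand)
        finally have "dlog_pairing (?f r s) (\<Otimes>\<^bsub>H1_Conf n\<^esub>j\<in>{1..n-1}. ?U j \<otimes>\<^bsub>H1_Conf n\<^esub>
            (\<Otimes>\<^bsub>H1_Conf n\<^esub>i\<in>{1..j-1}. ?T j i)) = (\<Sum>j\<in>{1..n-1}. if j = s - 1 then of_int ?F else 0)" .
        moreover have "s - 1 \<in> {1..n-1}"
          using rs by auto
        ultimately show ?thesis
          by (simp only: sum.delta finite_atLeastAtMost if_True)
      qed
      ultimately show "dlog_pairing (?f r s) (?b (X k)) = dlog_pairing (?f r s)
          (\<Otimes>\<^bsub>H1_Conf n\<^esub>j\<in>{1..n-1}. ?U j \<otimes>\<^bsub>H1_Conf n\<^esub> (\<Otimes>\<^bsub>H1_Conf n\<^esub>i\<in>{1..j-1}. ?T j i))"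
        by simp
    qed
  next

    \<comment> \<open>Images of the classes of the hypersurfaces\<close>
    fix H assume H: "H \<in> \<B>"
    let ?P = "{(i, j). 1 \<le> i \<and> i < j \<and> j \<le> l \<and> H \<in> meet_components d Hs i j}"
    have HI: "Inr H \<in> {1..d} <+> \<B>"
      using H by blast
    have XH_closed: "XH H \<in> carrier (homology_group 1 M)"
      using X_closed[OF HI] by simp
    have XH_coord: "dlog_pairing (\<lambda>x. x k) (XH H) = 0" if "k \<in> {1..d}" for k
      using X_dual[OF InlI[OF that] HI] by simp
    have XH_H: "dlog_pairing (defining_map H') (XH H) = (if H' = H then 1 else 0)" if "H' \<in> \<B>" for H'
      using X_dual[OF InrI[OF that] HI] by simp
    have sum_coord: "(\<Sum>k\<in>{1..d}. of_int (e k) * dlog_pairing (\<lambda>x. x k) (XH H)) = 0" for e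
      by (intro sum.neutral ballI) (simp add: XH_coord)
    have "?P \<subseteq> {1..l} \<times> {1..l}"
      by auto
    then have fin_P: "finite ?P"
      by (rule finite_subset) simp
    have P_index: "1 \<le> fst p + 1" "fst p + 1 < snd p + 1" "snd p + 1 \<le> n" if "p \<in> ?P" for p
      using that n by auto
    have P_closed: "A (fst p + 1) (snd p + 1) \<in> carrier (H1_Conf n)" if "p \<in> ?P" for p
      by (rule A_closed[OF P_index[OF that]])
    show "?b (XH H) = (\<Otimes>\<^bsub>H1_Conf n\<^esub>p\<in>?P. A (fst p + 1) (snd p + 1))"
    proof (rule eqI[OF b_closed])
      show "(\<Otimes>\<^bsub>H1_Conf n\<^esub>p\<in>?P. A (fst p + 1) (snd p + 1)) \<in> carrier (H1_Conf n)"
        by (intro finprod_closed Pi_I P_closed)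
      fix r s assume rs: "1 \<le> r" "r < s" "s \<le> n"
      \<comment> \<open>On \<open>XH H\<close> all coordinate forms vanish, and the sum over
        components keeps at most the single term for \<open>H\<close> itself.\<close>
      let ?c = "if r \<noteq> 1 \<and> H \<in> meet_components d Hs (r - 1) (s - 1) then 1 else 0 :: complex"
      have "dlog_pairing (?f r s) (?b (XH H)) = ?c"
      proof (cases "r = 1")
        case True
        then show ?thesis
          using dlog_pairing_root_map[OF XH_closed rs[unfolded n_eq]]
          by (simp only: sum_coord n_eq if_True) simp
      next
        case False
        have fm: "finite (meet_components d Hs (r - 1) (s - 1))"
          and sub: "meet_components d Hs (r - 1) (s - 1) \<subseteq> \<B>"
          using rs n_eq False by (intro finite_meet_components; auto)+
        have "(\<Sum>H'\<in>meet_components d Hs (r - 1) (s - 1). dlog_pairing (defining_map H') (XH H))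
            = (\<Sum>H'\<in>meet_components d Hs (r - 1) (s - 1). if H' = H then 1 else 0)"
          using sub by (intro sum.cong refl XH_H) blast
        also have "\<dots> = ?c"
          using fm False by (simp add: sum.delta)
        finally show ?thesis
          using dlog_pairing_root_map[OF XH_closed rs[unfolded n_eq]] False
          by (simp only: sum_coord n_eq if_False add_0_left)
      qed
      moreover have "dlog_pairing (?f r s) (\<Otimes>\<^bsub>H1_Conf n\<^esub>p\<in>?P. A (fst p + 1) (snd p + 1)) = ?c"
      proof -
        have "dlog_pairing (?f r s) (A (fst p + 1) (snd p + 1)) = (if p = (r - 1, s - 1) then 1 else 0)"
          if p: "p \<in> ?P" for p
        proof -
          have "(r = fst p + 1 \<and> s = snd p + 1) = (p = (r - 1, s - 1))"
            using rs p by auto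
          then show ?thesis
            using A_dual[OF rs P_index[OF p]] by simp
        qed
        then have "(\<Sum>p\<in>?P. dlog_pairing (?f r s) (A (fst p + 1) (snd p + 1)))
            = (\<Sum>p\<in>?P. if p = (r - 1, s - 1) then 1 else 0)"
          by (rule sum.cong[OF refl])
        moreover have "dlog_pairing (?f r s) (\<Otimes>\<^bsub>H1_Conf n\<^esub>p\<in>?P. A (fst p + 1) (snd p + 1))
            = (\<Sum>p\<in>?P. dlog_pairing (?f r s) (A (fst p + 1) (snd p + 1)))"
          by (intro dlog_pairing_finprod[OF nv[OF rs] fin_P] P_closed)
        ultimately have "dlog_pairing (?f r s) (\<Otimes>\<^bsub>H1_Conf n\<^esub>p\<in>?P. A (fst p + 1) (snd p + 1))
            = (\<Sum>p\<in>?P. if p = (r - 1, s - 1) then 1 else 0)"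
          by (simp only:)
        also have "\<dots> = (if (r - 1, s - 1) \<in> ?P then 1 else 0)"
          using fin_P by (rule sum.delta)
        \<comment> \<open>The index set requires a first entry of at least 1, which rules out
          \<open>r = 1\<close>.\<close>
        also have "(r - 1, s - 1) \<in> ?P \<longleftrightarrow> r \<noteq> 1 \<and> H \<in> meet_components d Hs (r - 1) (s - 1)"
          using rs n by auto
        finally show ?thesis .
      qed
      ultimately show "dlog_pairing (?f r s) (?b (XH H))
          = dlog_pairing (?f r s) (\<Otimes>\<^bsub>H1_Conf n\<^esub>p\<in>?P. A (fst p + 1) (snd p + 1))"
        by simp
    qed
  qed
qed

end
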